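(* For almost every (with respect to Lebesgue measure) irrational point $(a,b)\in\Omega$, the Diophantine exponent of $b/a$ is $e(b/a)=2$, so that both its even and odd Diophantine exponents satisfy $e^+(b/a)=e^-(b/a)=2$, and $$\limsup_{n\rightarrow+\infty}\frac{\log |f_n|}{\log n}=\limsup_{n\rightarrow+\infty}\frac{\log |f_{-n}|}{\log n}=\frac{1}{2},$$ where, for $n\ge1$, $f_n=\sum_{i=1}^n\left(k_i(a,b)-3\right)$ and $f_{-n}=\sum_{i=0}^n\left(k_{-i}(a,b)-3\right)$.
   Context: The BCZ triangle (Farey triangle) is $\Omega=\{(a,b)\in\mathbb{R}^2 : a,b\in(0,1],\ a+b>1\}$. With $[x]$ denoting the integer part (floor) of $x$, the itinerary function is $k(a,b)=\left[\frac{1+a}{b}\right]$ and the BCZ map $T:\Omega\to\Omega$ is the bijection $T(a,b)=\left(b,-a+\left[\frac{1+a}{b}\right]b\right)$. For $n\in\mathbb{Z}$, $k_n(a,b):=k(T^{n-1}(a,b))$. A point $(a,b)\in\Omega$ is called irrational if $b/a$ is irrational. For an irrational number $s$ (with $p/q$ in lowest terms, $q\ge1$, below): the Diophantine exponent $e(s)$ is the supremum of all $v\in\mathbb{R}$ such that $\left|s-\frac pq\right|<\frac1{q^v}$ has infinitely many solutions $\frac pq\in\mathbb{Q}$; the even Diophantine exponent $e^+(s)$ is the supremum of all $v\in\mathbb{R}$ such that $0<\frac pq-s<\frac1{q^v}$ has infinitely many solutions $\frac pq\in\mathbb{Q}$; the odd Diophantine exponent $e^-(s)$ is the supremum of all $v\in\mathbb{R}$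 such that $0<s-\frac pq<\frac1{q^v}$ has infinitely many solutions $\frac pq\in\mathbb{Q}$. Convention: $\log 0=-\infty$. *)

theory Defs
  imports "HOL-Analysis.Analysis"
begin

definition bcz_triangle :: "(real \<times> real) set" where
  "bcz_triangle = {(a, b). 0 < a \<and> a \<le> 1 \<and> 0 < b \<and> b \<le> 1 \<and> a + b > 1}"

definition bcz_k :: "real \<times> real \<Rightarrow> int" where
  "bcz_k = (\<lambda>(a, b). \<lfloor>(1 + a) / b\<rfloor>)"

definition bcz_map :: "real \<times> real \<Rightarrow> real \<times> real" where
  "bcz_map = (\<lambda>(a, b). (b, - a + of_int \<lfloor>(1 + a) / b\<rfloor> * b))"

text \<open>The BCZ map is a bijection of the triangle, so its negative iterates there are the
  iterates of the inverse relative to the triangle (as a map of the whole plane it is not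
  injective).\<close>

lemma bcz_map_in_triangle:
  assumes "p \<in> bcz_triangle"
  shows "bcz_map p \<in> bcz_triangle"
proof -
  obtain a b where p: "p = (a, b)" by (cases p)
  have *: "0 < a" "a \<le> 1" "0 < b" "b \<le> 1" "a + b > 1"
    using assms by (auto simp: bcz_triangle_def p)
  define k where "k = \<lfloor>(1 + a) / b\<rfloor>"
  have "of_int k \<le> (1 + a) / b" "(1 + a) / b < of_int k + 1"
    unfolding k_def by linarith+
  with * have "of_int k * b \<le> 1 + a" "1 + a < of_int k * b + b"
    by (simp_all add: field_simps)
  with * show ?thesis
    by (auto simp: bcz_triangle_def bcz_map_def p k_def[symmetric])
qed

lemma swap_bcz_map_involution:
  assumes "p \<in> bcz_triangle"
  shows "bcz_map (prod.swap (bcz_map p)) = prod.swap p"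
proof -
  obtain a b where p: "p = (a, b)" by (cases p)
  have *: "0 < a" "a \<le> 1" "0 < b" "b \<le> 1" "a + b > 1"
    using assms by (auto simp: bcz_triangle_def p)
  define k where "k = \<lfloor>(1 + a) / b\<rfloor>"
  have "(1 + (- a + of_int k * b)) / b = of_int k + (1 - a) / b"
    using * by (simp add: field_simps)
  moreover have "0 \<le> (1 - a) / b" "(1 - a) / b < 1"
    using * by (simp_all add: field_simps)
  ultimately have "\<lfloor>(1 + (- a + of_int k * b)) / b\<rfloor> = k"
    by (simp add: floor_eq_iff)
  then show ?thesis
    by (simp add: bcz_map_def p k_def[symmetric])
qed

lemma bij_betw_bcz_map: "bij_betw bcz_map bcz_triangle bcz_triangle"
proof (rule bij_betw_byWitness[where f' = "\<lambda>p. prod.swap (bcz_map (prod.swap p))"])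
  have swap: "prod.swap p \<in> bcz_triangle" if "p \<in> bcz_triangle" for p
    using that by (auto simp: bcz_triangle_def)
  show "\<forall>p\<in>bcz_triangle. prod.swap (bcz_map (prod.swap (bcz_map p))) = p"
    by (simp add: swap_bcz_map_involution)
  show "\<forall>p\<in>bcz_triangle. bcz_map (prod.swap (bcz_map (prod.swap p))) = p"
    by (simp add: swap swap_bcz_map_involution)
  show "bcz_map ` bcz_triangle \<subseteq> bcz_triangle"
    by (auto intro: bcz_map_in_triangle)
  show "(\<lambda>p. prod.swap (bcz_map (prod.swap p))) ` bcz_triangle \<subseteq> bcz_triangle"
    by (intro image_subsetI swap bcz_map_in_triangle)
qed

definition bcz_iter :: "int \<Rightarrow> real \<times> real \<Rightarrow> real \<times> real" where
  "bcz_iter n = (if n \<ge> 0 then bcz_map ^^ nat n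
                 else inv_into bcz_triangle bcz_map ^^ nat (- n))"

definition bcz_kn :: "int \<Rightarrow> real \<times> real \<Rightarrow> int" where
  "bcz_kn n p = bcz_k (bcz_iter (n - 1) p)"

definition bcz_f_pos :: "nat \<Rightarrow> real \<times> real \<Rightarrow> int" where
  "bcz_f_pos n p = (\<Sum>i=1..n. (bcz_kn (int i) p - 3))"

definition bcz_f_neg :: "nat \<Rightarrow> real \<times> real \<Rightarrow> int" where
  "bcz_f_neg n p = (\<Sum>i=0..n. (bcz_kn (- int i) p - 3))"

definition irrational_point :: "real \<times> real \<Rightarrow> bool" where
  "irrational_point = (\<lambda>(a, b). b / a \<notin> \<rat>)"

text \<open>\<^const>\<open>quotient_of\<close> gives the representation in lowest terms with positive denominator.\<close>

definition rat_denom :: "rat \<Rightarrow> real" where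
  "rat_denom r = of_int (snd (quotient_of r))"

definition dioph_exponent :: "real \<Rightarrow> ereal" where
  "dioph_exponent s =
    (SUP v\<in>{v::real. infinite {r::rat. \<bar>s - of_rat r\<bar> < 1 / rat_denom r powr v}}. ereal v)"

definition even_dioph_exponent :: "real \<Rightarrow> ereal" where
  "even_dioph_exponent s =
    (SUP v\<in>{v::real. infinite {r::rat. 0 < of_rat r - s \<and> of_rat r - s < 1 / rat_denom r powr v}}.
       ereal v)"

definition odd_dioph_exponent :: "real \<Rightarrow> ereal" where
  "odd_dioph_exponent s =
    (SUP v\<in>{v::real. infinite {r::rat. 0 < s - of_rat r \<and> s - of_rat r < 1 / rat_denom r powr v}}.
       ereal v)"

text \<open>Logarithm of a nonnegative real with the convention \<open>log 0 = -\<infinity>\<close>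
  (\<^term>\<open>ln (0::real)\<close> is \<open>0\<close> in the library).\<close>

definition elog :: "real \<Rightarrow> ereal" where
  "elog x = (if x = 0 then - \<infinity> else ereal (ln x))"

end

theory Submission
  imports Defs "HOL-Real_Asymp.Real_Asymp"
begin

text \<open>
  Write \<open>x\<^sub>n\<close> for the first coordinate of the \<open>n\<close>-th iterate of \<open>(a, b)\<close>, so that
  \<open>x\<^sub>n\<^sub>+\<^sub>1 + x\<^sub>n\<^sub>-\<^sub>1 = k\<^sub>n x\<^sub>n\<close>. Then \<open>x\<^sub>n\<close> is the value \<open>q\<^sub>n (a + b) - m\<^sub>n a\<close> of a linear form
  at integer vectors that satisfy the same recurrence and form consecutive bases of the
  lattice. These are exactly the primitive vectors in the strip where the form lies in
  \<open>(0, 1]\<close>, ordered by the slope \<open>m\<^sub>n / x\<^sub>n\<close>.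

  The sum \<open>f\<^sub>n\<close> of the \<open>k\<^sub>i - 3\<close> is, up to a constant, the alternating sum of the partial
  quotients in the Euclidean algorithm for \<open>(m\<^sub>n, m\<^sub>n\<^sub>+\<^sub>1)\<close>. If \<open>a / (a + b)\<close> has Diophantine
  exponent 2, each of these \<open>O(log n)\<close> quotients is at most the square root of the slope, up to
  an arbitrarily small power. The slope is comparable to \<open>n\<close>: its increments are
  \<open>(a + b) / (x\<^sub>n x\<^sub>n\<^sub>+\<^sub>1)\<close>, at least 1, and \<open>1 / x\<^sub>i \<le> 2 k\<^sub>i\<close> bounds their sum by a multiple of
  \<open>3 n + f\<^sub>n\<close> up to lower-order terms. Conversely, one-sided approximations with
  \<open>m x \<le> 2\<close> are infinitely many, each occurs in the orbit at a time of order at most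
  \<open>x\<^sup>-\<^sup>2\<close>, and there \<open>k\<^sub>n\<close> is at least of order \<open>\<surd>n\<close>. Backward orbits are forward orbits of
  the reflected point \<open>(b, a)\<close>.
\<close>

section \<open>Alternating sums of partial quotients\<close>

text \<open>The count of subtractive Euclidean steps, signed by which entry is reduced; on coprime
  pairs it is the alternating sum of the partial quotients of \<open>n / m\<close>, up to the treatment
  of the last one.\<close>

function euclid_balance :: "int \<Rightarrow> int \<Rightarrow> int" where
  "euclid_balance m n =
    (if m \<le> 0 \<or> n \<le> 0 \<or> m = n then 0
     else if m < n then euclid_balance m (n - m) + 1
     else euclid_balance (m - n) n - 1)"
  by auto
termination
  by (relation "Wellfounded.measure (\<lambda>(m, n). nat m + nat n)") auto

declare euclid_balance.simps [simp del]

lemma euclid_balance_add_right: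
  assumes "m > 0" "n > 0"
  shows "euclid_balance m (n + m) = euclid_balance m n + 1"
  using assms by (subst euclid_balance.simps) auto

lemma euclid_balance_add_left:
  assumes "m > 0" "n > 0"
  shows "euclid_balance (m + n) n = euclid_balance m n - 1"
  using assms by (subst euclid_balance.simps) auto

lemma euclid_balance_add_mult_right:
  assumes "m > 0" "n > 0" "c \<ge> 0"
  shows "euclid_balance m (n + c * m) = euclid_balance m n + c"
  using assms(3)
proof (induction c rule: int_ge_induct)
  case base
  show ?case by simp
next
  case (step c)
  have "euclid_balance m ((n + c * m) + m) = euclid_balance m (n + c * m) + 1"
    using assms step.hyps by (intro euclid_balance_add_right) (auto intro: add_pos_nonneg)
  then show ?case
    using step.IH by (simp add: algebra_simps)
qed

lemma euclid_balance_add_mult_left: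
  assumes "m > 0" "n > 0" "c \<ge> 0"
  shows "euclid_balance (m + c * n) n = euclid_balance m n - c"
  using assms(3)
proof (induction c rule: int_ge_induct)
  case base
  show ?case by simp
next
  case (step c)
  have "euclid_balance ((m + c * n) + n) n = euclid_balance (m + c * n) n - 1"
    using assms step.hyps by (intro euclid_balance_add_left) (auto intro: add_pos_nonneg)
  then show ?case
    using step.IH by (simp add: algebra_simps)
qed

text \<open>Links the orbit to the Euclidean count. For \<open>m < n\<close> three rewritings
  through \<open>n - m\<close> contribute \<open>k - 1\<close>, \<open>-1\<close> and
  \<open>-1\<close>. For \<open>m > n\<close> subtracting \<open>n\<close> from \<open>m\<close>
  lowers \<open>k\<close> by one and leaves \<open>k * n - m\<close> unchanged, so induction
  applies. Coprimality and \<open>n \<ge> 2\<close> exclude \<open>m = n\<close>.\<close>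

lemma euclid_balance_step:
  assumes "coprime m n" "m > 0" "n \<ge> 2" "k * n - m > 0"
  shows "euclid_balance n (k * n - m) = euclid_balance m n + k - 3"
  using assms
proof (induction "nat m" arbitrary: m k rule: less_induct)
  case less
  consider "m < n" | "m > n" | "m = n" by linarith
  then show ?case
  proof cases
    case 1
    have "k * n > 0"
      using less.prems by linarith
    then have k: "k \<ge> 1"
      using less.prems(3) zero_less_mult_iff[of k n] by auto
    have "euclid_balance n ((n - m) + (k - 1) * n) = euclid_balance n (n - m) + (k - 1)"
      using 1 k less.prems by (intro euclid_balance_add_mult_right) auto
    moreover have "euclid_balance (m + (n - m)) (n - m) = euclid_balance m (n - m) - 1"
      using 1 less.prems by (intro euclid_balance_add_left) auto
    moreover have "euclid_balance m ((n - m) + m) = euclid_balance m (n - m) + 1"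
      using 1 less.prems by (intro euclid_balance_add_right) auto
    ultimately show ?thesis
      by (simp add: algebra_simps)
  next
    case 2
    have "euclid_balance n ((k - 1) * n - (m - n)) = euclid_balance (m - n) n + (k - 1) - 3"
    proof (rule less.hyps)
      show "coprime (m - n) n"
        using less.prems(1) by (metis coprime_iff_gcd_eq_1 gcd_diff1)
    qed (use 2 less.prems in \<open>auto simp: algebra_simps\<close>)
    moreover have "euclid_balance ((m - n) + n) n = euclid_balance (m - n) n - 1"
      using 2 less.prems by (intro euclid_balance_add_left) auto
    ultimately show ?thesis
      by (simp add: algebra_simps)
  next
    case 3
    then show ?thesis using less.prems by auto
  qed
qed

text \<open>Here \<open>m\<close> is the denominator of a convergent of the fraction with denominator \<open>N\<close>, \<open>e\<close> the
  partial quotient that follows it, and \<open>x\<close>, \<open>X\<close> are the values of the linear form at the two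
  vectors. Either \<open>x\<close> is comparable to \<open>1 / (e m)\<close>, which makes \<open>e\<close> tiny, or \<open>m\<close> is almost
  as large as the square root of \<open>N / X\<close>, and \<open>e \<le> N / m\<close>.\<close>

lemma euclid_quotient_bound:
  fixes c \<epsilon> \<sigma> N X x m j e :: real
  assumes c: "0 < c" "c \<le> 1" and \<epsilon>: "0 < \<epsilon>" "\<epsilon> \<le> 1" and \<sigma>: "0 < \<sigma>" "\<sigma> \<le> 2"
    and X: "0 < X" "X \<le> 2" "2 \<le> N" and m: "1 \<le> m" and j: "1 \<le> j" and e: "1 \<le> e"
    and det: "\<bar>N * x - m * X\<bar> \<le> j * \<sigma>" and le: "e * m * j \<le> N"
    and x: "c * m powr (- 1 - \<epsilon>) \<le> \<bar>x\<bar>"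
  shows "e \<le> 8 / c * (N / X) powr ((1 + \<epsilon>) / 2)"
proof -
  define M where "M = N / X"
  have M: "N = M * X" "1 \<le> M"
    using X by (auto simp: M_def field_simps)
  have "N \<le> 2 * M"
    using X M mult_left_mono[of X 2 M] by (simp add: mult.commute)
  have "e * m \<le> e * m * j"
    using e m j mult_left_mono[of 1 j "e * m"] by auto
  then have em: "e * m \<le> 2 * M"
    using le \<open>N \<le> 2 * M\<close> by linarith
  have "m \<le> e * m"
    using e m mult_right_mono[of 1 e m] by auto
  then have "m \<le> 2 * M"
    using em by linarith
  then have "m powr \<epsilon> \<le> (2 * M) powr \<epsilon>"
    using m \<epsilon> by (intro powr_mono2) auto
  also have "\<dots> = 2 powr \<epsilon> * M powr \<epsilon>"
    using M by (simp add: powr_mult)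
  also have "\<dots> \<le> 2 * M powr \<epsilon>"
    using powr_mono[of \<epsilon> 1 2] \<epsilon> by (intro mult_right_mono) auto
  finally have m\<epsilon>: "m powr \<epsilon> \<le> 2 * M powr \<epsilon>" .
  have xm: "c \<le> m powr \<epsilon> * (m * \<bar>x\<bar>)"
  proof -
    have "c = m powr \<epsilon> * m * (c * m powr (- 1 - \<epsilon>))"
      using m by (simp add: powr_diff powr_minus field_simps)
    also have "\<dots> \<le> m powr \<epsilon> * m * \<bar>x\<bar>"
      using x m by (intro mult_left_mono) auto
    finally show ?thesis by (simp add: mult.assoc)
  qed
  have "N * \<bar>x\<bar> = \<bar>N * x\<bar>"
    using X by (simp add: abs_mult)
  also have "\<dots> \<le> j * \<sigma> + m * X"
  proof -
    have "0 < m * X"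
      using X m by simp
    then show ?thesis
      using det by linarith
  qed
  finally have Nx: "N * \<bar>x\<bar> \<le> j * \<sigma> + m * X" .
  \<comment> \<open>The larger of the two summands in \<open>Nx\<close> carries at least half of the
    bound.\<close>
  consider "N * \<bar>x\<bar> \<le> 2 * (j * \<sigma>)" | "N * \<bar>x\<bar> \<le> 2 * (m * X)"
    using Nx by linarith
  then show ?thesis
  proof cases
    case 1
    have "e * m * j * \<bar>x\<bar> \<le> N * \<bar>x\<bar>"
      using le by (intro mult_right_mono) auto
    then have "(e * (m * \<bar>x\<bar>)) * j \<le> (2 * \<sigma>) * j"
      using 1 by (simp add: mult_ac)
    then have "e * (m * \<bar>x\<bar>) \<le> 2 * \<sigma>"
      using j by (simp only: mult_le_cancel_right_pos)
    then have ex: "e * (m * \<bar>x\<bar>) \<le> 4"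
      using \<sigma> by linarith
    have "e * c \<le> e * (m powr \<epsilon> * (m * \<bar>x\<bar>))"
      using xm e by (intro mult_left_mono) auto
    also have "\<dots> = m powr \<epsilon> * (e * (m * \<bar>x\<bar>))"
      by simp
    also have "\<dots> \<le> (2 * M powr \<epsilon>) * 4"
      using ex m\<epsilon> e m by (intro mult_mono) auto
    also have "\<dots> \<le> 8 * M powr ((1 + \<epsilon>) / 2)"
      using M \<epsilon> by (simp add: powr_mono)
    finally show ?thesis
      using c by (simp add: M_def field_simps)
  next
    case 2
    have "(M * \<bar>x\<bar>) * X \<le> (2 * m) * X"
      using 2 M by (simp add: mult_ac)
    then have Mx: "M * \<bar>x\<bar> \<le> 2 * m"
      using X by (simp only: mult_le_cancel_right_pos)
    have "c * M \<le> m powr \<epsilon> * (m * \<bar>x\<bar>) * M"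
      using xm M by (intro mult_right_mono) auto
    also have "\<dots> = m powr \<epsilon> * m * (M * \<bar>x\<bar>)"
      by simp
    also have "\<dots> \<le> m powr \<epsilon> * m * (2 * m)"
      using Mx m by (intro mult_left_mono) auto
    also have "\<dots> \<le> (2 * M powr \<epsilon>) * m * (2 * m)"
      using m\<epsilon> m by (intro mult_right_mono) auto
    finally have cM: "c * M \<le> 4 * M powr \<epsilon> * m\<^sup>2"
      by (simp add: power2_eq_square)
    have "e\<^sup>2 * m\<^sup>2 \<le> (2 * M)\<^sup>2"
      using power_mono[OF em, of 2] e m by (simp add: power_mult_distrib)
    then have "(e\<^sup>2 * c) * M \<le> (e\<^sup>2 * m\<^sup>2) * (4 * M powr \<epsilon>)"
      using mult_left_mono[OF cM, of "e\<^sup>2"] by (simp add: mult_ac)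
    also have "\<dots> \<le> (2 * M)\<^sup>2 * (4 * M powr \<epsilon>)"
      using \<open>e\<^sup>2 * m\<^sup>2 \<le> (2 * M)\<^sup>2\<close> by (intro mult_right_mono) auto
    also have "\<dots> = (16 * (M * M powr \<epsilon>)) * M"
      by (simp add: power2_eq_square)
    finally have "e\<^sup>2 * c \<le> 16 * (M * M powr \<epsilon>)"
      using M by (simp only: mult_le_cancel_right_pos)
    also have "M * M powr \<epsilon> = (M powr ((1 + \<epsilon>) / 2))\<^sup>2"
      using M by (simp add: power2_eq_square flip: powr_add) (simp add: powr_add)
    finally have "e\<^sup>2 * c \<le> 16 * (M powr ((1 + \<epsilon>) / 2))\<^sup>2" .
    \<comment> \<open>A second factor \<open>c \<le> 1\<close> makes the left side a square, so that
      a root can be taken.\<close>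
    then have "e\<^sup>2 * c * c \<le> 16 * (M powr ((1 + \<epsilon>) / 2))\<^sup>2"
      using c mult_left_le[of c "e\<^sup>2 * c"] by simp
    then have "(e * c)\<^sup>2 \<le> (4 * M powr ((1 + \<epsilon>) / 2))\<^sup>2"
      by (simp add: power2_eq_square mult_ac)
    then have "e * c \<le> 4 * M powr ((1 + \<epsilon>) / 2)"
      by (rule power2_le_imp_le) simp
    also have "\<dots> \<le> 8 * M powr ((1 + \<epsilon>) / 2)" by simp
    finally show ?thesis
      using c by (simp add: M_def field_simps)
  qed
qed

text \<open>The vector \<open>(N, X)\<close> stays fixed in the induction; it is an interior point of all the cones
  spanned by the pairs that occur in the algorithm.\<close>

lemma euclid_balance_bound:
  fixes a c \<epsilon> \<sigma> N X i j :: real and m n q l :: int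
  defines "x \<equiv> q * \<sigma> - m * a" and "y \<equiv> l * \<sigma> - n * a"
  assumes c: "0 < c" "c \<le> 1" and \<epsilon>: "0 < \<epsilon>" "\<epsilon> \<le> 1" and \<sigma>: "0 < \<sigma>" "\<sigma> \<le> 2"
    and dioph: "\<And>(q::int) (t::int). t \<ge> (1::int) \<Longrightarrow> c * t powr (- 1 - \<epsilon>) \<le> \<bar>q * \<sigma> - t * a\<bar>"
    and det: "n * q - m * l = 1" and pos: "m \<ge> 1" "n \<ge> 1"
    and ij: "i \<ge> 1" "j \<ge> 1"
    and N: "N = i * m + j * n" and X: "X = i * x + j * y" "0 < X" "X \<le> 2"
  shows "\<bar>real_of_int (euclid_balance m n)\<bar>
           \<le> 8 / c * (N / X) powr ((1 + \<epsilon>) / 2) * log 2 (m * n)"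
  using assms unfolding x_def y_def
proof (induction "nat (m + n)" arbitrary: m n q l i j rule: less_induct)
  case less
  define x y where xy: "x = q * \<sigma> - m * a" "y = l * \<sigma> - n * a"
  define B where "B = 8 / c * (N / X) powr ((1 + \<epsilon>) / 2)"
  have B: "B \<ge> 0"
    using c by (simp add: B_def)
  have m: "m \<ge> 1" and n: "n \<ge> 1" and det: "n * q - m * l = 1"
    and i: "i \<ge> 1" and j: "j \<ge> 1" and N: "N = i * m + j * n" and X: "X = i * x + j * y" "0 < X" "X \<le> 2"
    using less.prems by (auto simp: xy)
  have det': "n * x - m * y = \<sigma>"
  proof -
    have "n * x - m * y = (n * q - m * l) * \<sigma>"
      by (simp add: xy algebra_simps)
    then show ?thesis using det by simp
  qed
  have im: "i * m \<ge> i" "j * n \<ge> j"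
    using i j m n mult_left_mono[of 1 "real_of_int m" i] mult_left_mono[of 1 "real_of_int n" j] by auto
  then have "N \<ge> 2"
    using i j N by linarith
  note bound = euclid_quotient_bound[OF c \<epsilon> \<sigma> \<open>0 < X\<close> \<open>X \<le> 2\<close> \<open>N \<ge> 2\<close>]
  \<comment> \<open>One block of subtractions at least halves the product \<open>m * n\<close>; the
    drop of its logarithm by one pays for the partial quotient \<open>e \<le> B\<close>.\<close>
  have log_step: "B * log 2 u + B \<le> B * log 2 w" if "u > 0" "w \<ge> 2 * u" for u w
  proof -
    have "1 + log 2 u = log 2 (2 * u)"
      using that by (simp add: log_mult)
    also have "\<dots> \<le> log 2 w"
      using that by simp
    finally show ?thesis
      using mult_left_mono[OF _ B] by (fastforce simp: algebra_simps)
  qed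
  consider "m = n" | "m < n" | "n < m" by linarith
  then show ?case
  proof cases
    case 1
    then have "m dvd 1"
      using det by (metis dvd_triv_left right_diff_distrib)
    then have "m = 1" "n = 1"
      using 1 m by auto
    then show ?thesis
      by (simp add: euclid_balance.simps)
  next
    case 2
    \<comment> \<open>Dividing \<open>n - 1\<close> rather than \<open>n\<close> keeps the remainder
      \<open>n'\<close> in \<open>{1..m}\<close>, so the reduced pair is again positive.\<close>
    define e where "e = (n - 1) div m"
    define n' where "n' = n - e * m"
    define l' where "l' = l - e * q"
    have "(n - 1) mod m = n - 1 - e * m"
      by (simp add: e_def minus_div_mult_eq_mod)
    moreover have "0 \<le> (n - 1) mod m" "(n - 1) mod m < m"
      using m by auto
    ultimately have n': "1 \<le> n'" "n' \<le> m"
      by (auto simp: n'_def)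
    have e: "1 \<le> e"
      using 2 m by (simp add: e_def pos_imp_zdiv_pos_iff int_one_le_iff_zero_less)
    have em: "e * m \<ge> m" "e * m < n"
      using e m n' by (auto simp: n'_def)
    have bal: "euclid_balance m n = euclid_balance m n' + e"
      using euclid_balance_add_mult_right[of m n' e] m n' e by (simp add: n'_def)
    have "e \<le> B"
      unfolding B_def
    proof (rule bound)
      \<comment> \<open>Since \<open>(N, X) = i (m, x) + j (n, y)\<close>, only the second summand
        contributes to the determinant with \<open>(m, x)\<close>.\<close>
      have "N * x - m * X = j * (n * x - m * y)"
        by (simp add: N X algebra_simps)
      then show "\<bar>N * x - m * X\<bar> \<le> j * \<sigma>"
        using det' j \<sigma> by simp
      have "real_of_int (e * m) * j \<le> j * n"
        unfolding mult.commute[of j] using em j by (intro mult_right_mono) (auto simp del: of_int_mult)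
      then have "real_of_int (e * m) * j \<le> N"
        unfolding N using i m by (intro add_increasing) auto
      then show "real_of_int e * real_of_int m * j \<le> N"
        by simp
      show "c * m powr (- 1 - \<epsilon>) \<le> \<bar>x\<bar>"
        using less.prems(7)[of m q] m by (simp add: xy)
    qed (use m j e in auto)
    moreover have "\<bar>real_of_int (euclid_balance m n')\<bar> \<le> B * log 2 (m * n')"
      unfolding B_def
    proof (rule less.hyps)
      show "nat (m + n') < nat (m + n)"
        using em m n n' by (simp add: n'_def)
      show "n' * q - m * l' = 1"
        using det by (simp add: n'_def l'_def algebra_simps)
      \<comment> \<open>In the reduced basis the fixed vector \<open>(N, X)\<close> has the
        coordinates \<open>i + j * e\<close> and \<open>j\<close>.\<close>
      show "1 \<le> i + j * e"
        using i j e by (simp add: add_increasing2)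
      show "N = (i + j * e) * m + j * n'"
        by (simp add: N n'_def algebra_simps)
      show "X = (i + j * e) * (q * \<sigma> - m * a) + j * (l' * \<sigma> - n' * a)"
        by (simp add: X xy n'_def l'_def algebra_simps)
    qed (use less.prems n' in auto)
    moreover have "B * log 2 (m * n') + B \<le> B * log 2 (m * n)"
    proof (rule log_step)
      have "2 * n' \<le> n"
        using add_left_mono[OF order.trans[OF n'(2) em(1)], of n'] by (simp add: n'_def)
      then have "2 * (m * n') \<le> m * n"
        using m by simp
      then have "real_of_int (2 * (m * n')) \<le> real_of_int (m * n)"
        by (simp only: of_int_le_iff)
      then show "2 * real_of_int (m * n') \<le> real_of_int (m * n)"
        by simp
    qed (use m n' in auto)
    ultimately show ?thesis
      using e unfolding bal B_def[symmetric] by simp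
  next
    case 3
    define e where "e = (m - 1) div n"
    define m' where "m' = m - e * n"
    define q' where "q' = q - e * l"
    have "(m - 1) mod n = m - 1 - e * n"
      by (simp add: e_def minus_div_mult_eq_mod)
    moreover have "0 \<le> (m - 1) mod n" "(m - 1) mod n < n"
      using n by auto
    ultimately have m': "1 \<le> m'" "m' \<le> n"
      by (auto simp: m'_def)
    have e: "1 \<le> e"
      using 3 n by (simp add: e_def pos_imp_zdiv_pos_iff int_one_le_iff_zero_less)
    have en: "e * n \<ge> n" "e * n < m"
      using e n m' by (auto simp: m'_def)
    have bal: "euclid_balance m n = euclid_balance m' n - e"
      using euclid_balance_add_mult_left[of m' n e] n m' e by (simp add: m'_def)
    have "e \<le> B"
      unfolding B_def
    proof (rule bound)
      have "N * y - n * X = - i * (n * x - m * y)"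
        by (simp add: N X algebra_simps)
      then show "\<bar>N * y - n * X\<bar> \<le> i * \<sigma>"
        using det' i \<sigma> by simp
      have "real_of_int (e * n) * i \<le> i * m"
        unfolding mult.commute[of i] using en i by (intro mult_right_mono) (auto simp del: of_int_mult)
      then have "real_of_int (e * n) * i \<le> N"
        unfolding N using j n by (intro add_increasing2) auto
      then show "real_of_int e * real_of_int n * i \<le> N"
        by simp
      show "c * n powr (- 1 - \<epsilon>) \<le> \<bar>y\<bar>"
        using less.prems(7)[of n l] n by (simp add: xy)
    qed (use n i e in auto)
    moreover have "\<bar>real_of_int (euclid_balance m' n)\<bar> \<le> B * log 2 (m' * n)"
      unfolding B_def
    proof (rule less.hyps)
      show "nat (m' + n) < nat (m + n)"
        using en m n m' by (simp add: m'_def)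
      show "n * q' - m' * l = 1"
        using det by (simp add: m'_def q'_def algebra_simps)
      show "1 \<le> i" by fact
      show "1 \<le> j + i * e"
        using i j e by (simp add: add_increasing2)
      show "N = i * m' + (j + i * e) * n"
        by (simp add: N m'_def algebra_simps)
      show "X = i * (q' * \<sigma> - m' * a) + (j + i * e) * (l * \<sigma> - n * a)"
        by (simp add: X xy m'_def q'_def algebra_simps)
    qed (use less.prems m' in auto)
    moreover have "B * log 2 (m' * n) + B \<le> B * log 2 (m * n)"
    proof (rule log_step)
      have "2 * m' \<le> m"
        using add_left_mono[OF order.trans[OF m'(2) en(1)], of m'] by (simp add: m'_def)
      then have "2 * (m' * n) \<le> m * n"
        using n by simp
      then have "real_of_int (2 * (m' * n)) \<le> real_of_int (m * n)"
        by (simp only: of_int_le_iff)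
      then show "2 * real_of_int (m' * n) \<le> real_of_int (m * n)"
        by simp
    qed (use n m' in auto)
    ultimately show ?thesis
      using e unfolding bal B_def[symmetric] by simp
  qed
qed

section \<open>Diophantine approximation\<close>

text \<open>Irrationality exponent at most 2, multiplied through by \<open>q\<close>. A constant
  \<open>c\<close> uniform in \<open>q\<close> takes the place of finitely many exceptions.\<close>

definition almost_badly_approximable :: "real \<Rightarrow> bool" where
  "almost_badly_approximable s \<longleftrightarrow>
    (\<forall>\<epsilon>>0. \<exists>c>0. \<forall>q\<ge>1::int. \<forall>p::int. c * of_int q powr (- 1 - \<epsilon>) \<le> \<bar>of_int q * s - of_int p\<bar>)"

text \<open>If Dirichlet's approximation \<open>h / k\<close> lies on the wrong side, complete \<open>(h, k)\<close> to a lattice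
  basis by a vector just before it crosses to that side.\<close>

lemma one_sided_Dirichlet_approx:
  fixes \<theta> :: real and N :: nat
  assumes "\<theta> \<notin> \<rat>" "N > 0"
  obtains p q :: int where "q > 0" "0 < q * \<theta> - p" "q * \<theta> - p < 1 / N" "q * (q * \<theta> - p) < 1"
proof -
  obtain h k where cop: "coprime h k" and k: "0 < k" "k \<le> int N"
    and hk: "\<bar>of_int k * \<theta> - of_int h\<bar> < 1 / N"
    using Dirichlet_approx_coprime[OF assms(2)] by blast
  have kN: "k * \<bar>of_int k * \<theta> - of_int h\<bar> < 1"
  proof -
    have "real_of_int k * \<bar>of_int k * \<theta> - of_int h\<bar> < real_of_int k * (1 / N)"
      using hk k by (intro mult_strict_left_mono) auto
    also have "\<dots> \<le> 1"
      using k assms by (simp add: field_simps)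
    finally show ?thesis .
  qed
  have irr: "of_int q * \<theta> \<noteq> of_int p" if "q \<noteq> 0" for p q :: int
  proof
    assume "of_int q * \<theta> = of_int p"
    then have "\<theta> = of_int p / of_int q"
      using that by (simp add: field_simps)
    then show False using assms(1) by auto
  qed
  show thesis
  proof (cases "of_int k * \<theta> > of_int h")
    case True
    then show thesis
      using that[of k h] hk kN k by auto
  next
    case False
    define \<delta> where "\<delta> = h - k * \<theta>"
    have \<delta>: "0 < \<delta>" "\<delta> < 1 / N" "k * \<delta> < 1"
      using False irr[of k h] hk k kN by (auto simp: \<delta>_def abs_if split: if_splits)
    obtain u v where uv: "u * h + v * k = 1"
      using cop bezout_int[of h k] by auto
    define y where "y = u * \<theta> + v"
    \<comment> \<open>The last shift before \<open>y - j * \<delta>\<close> ceases to be positive,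
      so the value lands between 0 and \<open>\<delta>\<close>.\<close>
    define j where "j = \<lceil>y / \<delta>\<rceil> - 1"
    define q where "q = u + j * k"
    define p where "p = - v + j * h"
    have L: "q * \<theta> - p = y - j * \<delta>"
      by (simp add: q_def p_def y_def \<delta>_def algebra_simps)
    have "j < y / \<delta>" "y / \<delta> \<le> j + 1"
      unfolding j_def by linarith+
    then have L2: "0 < q * \<theta> - p" "q * \<theta> - p \<le> \<delta>"
      using \<delta> unfolding L by (simp_all add: field_simps)
    have det: "q * h - k * p = 1"
      using uv by (simp add: q_def p_def algebra_simps)
    \<comment> \<open>Unimodularity makes two positive terms sum to 1, which bounds
      \<open>q * \<delta>\<close> and hence \<open>q * (q * \<theta> - p)\<close>.\<close>
    have "k * (q * \<theta> - p) + q * \<delta> = (q * h - k * p)"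
      by (simp add: \<delta>_def algebra_simps)
    then have eq: "k * (q * \<theta> - p) + q * \<delta> = 1"
      using det by simp
    have "k * (q * \<theta> - p) \<le> k * \<delta>"
      using L2 k by (intro mult_left_mono) auto
    then have "q * \<delta> > 0"
      using eq \<delta> by linarith
    then have q: "q > 0"
      using \<delta> by (simp add: zero_less_mult_iff)
    have "q * (q * \<theta> - p) \<le> q * \<delta>"
      using L2 q by (intro mult_left_mono) auto
    moreover have "k * (q * \<theta> - p) > 0"
      using L2 k by simp
    ultimately have "q * (q * \<theta> - p) < 1"
      using eq by linarith
    then show thesis
      using that[of q p] q L2 \<delta> by auto
  qed
qed

section \<open>Metric theory: almost every real is almost badly approximable\<close>

lemma irrational_distance_to_integers:
  fixes x :: real
  assumes "x \<notin> \<int>"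
  obtains d where "d > 0" "\<And>p::int. d \<le> \<bar>x - of_int p\<bar>"
proof
  show "min (frac x) (1 - frac x) > 0"
    using assms frac_lt_1[of x] by (simp add: frac_gt_0_iff)
  show "min (frac x) (1 - frac x) \<le> \<bar>x - p\<bar>" for p :: int
  proof (cases "p \<le> \<lfloor>x\<rfloor>")
    case True
    then have "real_of_int p \<le> \<lfloor>x\<rfloor>" by simp
    then show ?thesis by (simp add: frac_def)
  next
    case False
    then have "real_of_int p \<ge> \<lfloor>x\<rfloor> + 1" by linarith
    then show ?thesis by (simp add: frac_def)
  qed
qed

text \<open>The convergence part of Khinchin's theorem, by Borel-Cantelli: for denominator
  \<open>q\<close> the exceptional points in \<open>[-K, K]\<close> are covered by order
  \<open>q\<close> intervals of length \<open>2 * q powr (- 2 - \<epsilon>)\<close>, and the total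
  lengths are summable over \<open>q\<close>.\<close>

lemma AE_finite_good_approximations:
  fixes K :: nat and \<epsilon> :: real
  assumes \<epsilon>: "\<epsilon> > 0"
  shows "AE s in lborel. \<bar>s\<bar> \<le> K \<longrightarrow>
    (\<forall>\<^sub>F q in sequentially. \<forall>p::int. real q powr (- 1 - \<epsilon>) \<le> \<bar>real q * s - of_int p\<bar>)"
proof -
  define I where "I q p = {s. \<bar>real q * s - of_int p\<bar> < real q powr (- 1 - \<epsilon>)}" for q :: nat and p :: int
  \<comment> \<open>For \<open>\<bar>s\<bar> \<le> K\<close> only these \<open>p\<close> can come
    within distance 1 of \<open>q * s\<close>.\<close>
  define P where "P q = {- (int (K * q) + 1)..int (K * q) + 1}" for q
  define A where "A q = (if q = 0 then {} else \<Union>p\<in>P q. I q p)" for q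
  have I_eq: "I q p = {p / q - q powr (- 2 - \<epsilon>)<..<p / q + q powr (- 2 - \<epsilon>)}" if "q > 0" for q p
  proof -
    have "real q powr (- 1 - \<epsilon>) = q * q powr (- 2 - \<epsilon>)"
      using that by (simp add: powr_mult_base)
    moreover have "\<bar>real q * s - p\<bar> = q * \<bar>s - p / q\<bar>" for s
    proof -
      have "real q * s - p = q * (s - p / q)"
        using that by (simp add: field_simps)
      then show ?thesis by (simp add: abs_mult)
    qed
    ultimately have "I q p = {s. \<bar>s - p / q\<bar> < q powr (- 2 - \<epsilon>)}"
      using that by (simp add: I_def)
    moreover have "{s. \<bar>s - c\<bar> < d} = {c - d<..<c + d}" for c d :: real
      by auto
    ultimately show ?thesis by simp
  qed
  have A_sets: "A q \<in> sets lborel" for q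
    by (auto simp: A_def I_eq P_def)
  have emI: "emeasure lborel (I q p) = ennreal (2 * q powr (- 2 - \<epsilon>))" if "q > 0" for q p
    using that by (simp add: I_eq)
  have em: "emeasure lborel (A q) \<le> ennreal ((4 * K + 6) * q powr (- 1 - \<epsilon>))" for q
  proof (cases "q = 0")
    case False
    have "emeasure lborel (A q) \<le> (\<Sum>p\<in>P q. emeasure lborel (I q p))"
      using False unfolding A_def if_not_P[OF False]
      by (intro emeasure_subadditive_finite) (auto simp: P_def I_eq)
    also have "\<dots> = (\<Sum>p\<in>P q. ennreal (2 * q powr (- 2 - \<epsilon>)))"
      using False emI by (intro sum.cong) auto
    also have "\<dots> = ennreal ((\<Sum>p\<in>P q. 2 * q powr (- 2 - \<epsilon>)))"
      by (rule sum_ennreal) auto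
    also have "(\<Sum>p\<in>P q. 2 * q powr (- 2 - \<epsilon>)) = (2 * (K * q) + 3) * (2 * q powr (- 2 - \<epsilon>))"
      by (simp add: P_def algebra_simps)
    also have "\<dots> \<le> ((2 * K + 3) * q) * (2 * q powr (- 2 - \<epsilon>))"
      using False by (intro mult_right_mono) (auto simp: algebra_simps)
    also have "\<dots> = (4 * K + 6) * (q * q powr (- 2 - \<epsilon>))"
      by (simp add: algebra_simps)
    also have "q * q powr (- 2 - \<epsilon>) = q powr (- 1 - \<epsilon>)"
      using False by (simp add: powr_mult_base)
    finally show ?thesis
      by (simp add: ennreal_leI)
  qed (simp add: A_def)
  have "AE s in lborel. eventually (\<lambda>q. s \<in> space lborel - A q) sequentially"
  proof (rule borel_cantelli_AE1)
    show "A q \<in> sets lborel" for q by fact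
    show "emeasure lborel (A q) < \<infinity>" for q
      using em[of q] by (rule order.strict_trans1) simp
    show "summable (\<lambda>q. measure lborel (A q))"
    proof (rule summable_comparison_test')
      show "summable (\<lambda>q. (4 * real K + 6) * real q powr (- 1 - \<epsilon>))"
        using \<epsilon> by (intro summable_mult) (simp add: summable_real_powr_iff)
      show "norm (measure lborel (A q)) \<le> (4 * real K + 6) * real q powr (- 1 - \<epsilon>)" for q
        using em[of q] by (simp add: measure_def enn2real_leI)
    qed
  qed
  then show ?thesis
  proof eventually_elim
    case (elim s)
    show ?case
    proof
      assume s: "\<bar>s\<bar> \<le> K"
      show "\<forall>\<^sub>F q in sequentially. \<forall>p::int. real q powr (- 1 - \<epsilon>) \<le> \<bar>real q * s - of_int p\<bar>"
        using elim eventually_gt_at_top[of 0]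
      proof eventually_elim
        case (elim q)
        show ?case
        proof (rule allI, rule ccontr)
          fix p :: int
          assume *: "\<not> real q powr (- 1 - \<epsilon>) \<le> \<bar>real q * s - of_int p\<bar>"
          have "real q powr (- 1 - \<epsilon>) \<le> 1 powr (- 1 - \<epsilon>)"
            using elim \<epsilon> by (intro powr_mono2') auto
          then have "\<bar>q * s - p\<bar> < 1"
            using * by simp
          moreover have "\<bar>q * s\<bar> \<le> K * q"
            using s by (simp add: abs_mult mult.commute mult_right_mono)
          ultimately have "real_of_int \<bar>p\<bar> \<le> real_of_int (int (K * q) + 1)"
            by simp
          then have "\<bar>p\<bar> \<le> int (K * q) + 1"
            by (simp only: of_int_le_iff)
          then have "p \<in> P q"
            by (auto simp: P_def)
          then show False
            using elim * by (auto simp: A_def I_def)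
        qed
      qed
    qed
  qed
qed

lemma AE_almost_badly_approximable: "AE s in lborel. almost_badly_approximable s"
proof -
  \<comment> \<open>Countably many \<open>K\<close> and \<open>j\<close> exhaust the line and let
    the exponent tend to \<open>-1\<close>, so a single null set serves all
    \<open>\<epsilon>\<close>.\<close>
  have "AE s in lborel. \<forall>K::nat. \<forall>j::nat. \<bar>s\<bar> \<le> K \<longrightarrow>
    (\<forall>\<^sub>F q in sequentially. \<forall>p::int. real q powr (- 1 - 1 / Suc j) \<le> \<bar>real q * s - of_int p\<bar>)"
    unfolding AE_all_countable by (intro allI AE_finite_good_approximations) simp
  moreover have "AE s in lborel. s \<notin> (\<rat> :: real set)"
    by (intro AE_not_in countable_imp_null_set_lborel countable_rat)
  ultimately show ?thesis
  proof eventually_elim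
    case (elim s)
    show ?case
      unfolding almost_badly_approximable_def
    proof (intro allI impI)
      fix \<epsilon> :: real
      assume "\<epsilon> > 0"
      then obtain j where j: "1 / real (Suc j) < \<epsilon>"
        by (meson nat_approx_posE)
      obtain K :: nat where "\<bar>s\<bar> \<le> K"
        using real_arch_simple by blast
      then obtain q0 where q0: "\<And>q p. q \<ge> q0 \<Longrightarrow> real q powr (- 1 - 1 / Suc j) \<le> \<bar>q * s - of_int p\<bar>"
        using elim(1) unfolding eventually_sequentially by blast
      \<comment> \<open>The eventual bound starts at \<open>q0\<close>. For each smaller
        \<open>q\<close> the irrationality of \<open>s\<close> keeps \<open>q * s\<close> at a
        positive distance from the integers.\<close>
      have "\<forall>q\<in>{1..int q0}. \<exists>d>0. \<forall>p::int. d \<le> \<bar>of_int q * s - of_int p\<bar>"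
      proof
        fix q assume q: "q \<in> {1..int q0}"
        have "q * s \<notin> \<int>"
        proof
          assume "q * s \<in> \<int>"
          then obtain z :: int where "q * s = z" by (auto elim: Ints_cases)
          then have "s = z / q"
            using q by (simp add: field_simps)
          then show False using elim(2) by auto
        qed
        then show "\<exists>d>0. \<forall>p::int. d \<le> \<bar>of_int q * s - of_int p\<bar>"
          using irrational_distance_to_integers by metis
      qed
      then obtain d where d: "\<And>q. q \<in> {1..int q0} \<Longrightarrow> d q > 0"
        "\<And>q p::int. q \<in> {1..int q0} \<Longrightarrow> d q \<le> \<bar>q * s - p\<bar>"
        by metis
      \<comment> \<open>Inserting 1 gives \<open>c \<le> 1\<close>, so the same constant works
        beyond \<open>q0\<close>.\<close>
      define c where "c = Min (insert 1 (d ` {1..int q0}))"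
      have c: "c > 0" "c \<le> 1"
        using d by (auto simp: c_def)
      have cd: "c \<le> d q" if "q \<in> {1..int q0}" for q
        unfolding c_def using that by (intro Min_le) auto
      show "\<exists>c>0. \<forall>q\<ge>1::int. \<forall>p::int. c * of_int q powr (- 1 - \<epsilon>) \<le> \<bar>of_int q * s - of_int p\<bar>"
      proof (intro exI conjI allI impI)
        fix q p :: int
        assume q: "q \<ge> 1"
        show "c * of_int q powr (- 1 - \<epsilon>) \<le> \<bar>of_int q * s - of_int p\<bar>"
        proof (cases "q \<le> int q0")
          case True
          have "q powr (- 1 - \<epsilon>) \<le> 1 powr (- 1 - \<epsilon>)"
            using q \<open>\<epsilon> > 0\<close> by (intro powr_mono2') auto
          then have "c * q powr (- 1 - \<epsilon>) \<le> c * 1"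
            using c by (intro mult_left_mono) auto
          also have "\<dots> \<le> \<bar>q * s - p\<bar>"
            using cd[of q] d(2)[of q p] True q by simp
          finally show ?thesis .
        next
          case False
          have "c * q powr (- 1 - \<epsilon>) \<le> 1 * q powr (- 1 - \<epsilon>)"
            using c by (intro mult_right_mono) auto
          also have "\<dots> \<le> q powr (- 1 - 1 / Suc j)"
            using q j by (simp add: powr_mono)
          also have "\<dots> = real (nat q) powr (- 1 - 1 / Suc j)"
            using q by simp
          also have "\<dots> \<le> \<bar>real (nat q) * s - p\<bar>"
            using False by (intro q0) auto
          finally show ?thesis
            using q by simp
        qed
      qed (fact c)
    qed
  qed
qed

text \<open>Fubini: for fixed \<open>a > 0\<close> the scaling by \<open>1 / a\<close> pulls null
  sets back to null sets. A Borel null set \<open>N\<close> covering the exceptions supplies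
  measurability; completion then passes to Lebesgue measure.\<close>

lemma AE_ratio:
  fixes P :: "real \<Rightarrow> bool"
  assumes "AE s in lborel. P s"
  shows "AE p in (lebesgue :: (real \<times> real) measure). fst p > 0 \<longrightarrow> P (snd p / fst p)"
proof -
  obtain N where N: "N \<in> null_sets lborel" "{s. \<not> P s} \<subseteq> N"
    using assms by (auto simp: eventually_ae_filter)
  have [measurable]: "N \<in> sets borel"
    using N by auto
  have "AE p in (lborel \<Otimes>\<^sub>M lborel :: (real \<times> real) measure). fst p > 0 \<longrightarrow> snd p / fst p \<notin> N"
  proof (rule lborel_pair.AE_pair_measure)
    show "{x \<in> space (lborel \<Otimes>\<^sub>M lborel). 0 < fst x \<longrightarrow> snd x / fst x \<notin> N} \<in> sets (lborel \<Otimes>\<^sub>M lborel)"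
      by measurable
    have "AE s in lborel. s \<notin> N"
      using N by (intro AE_not_in) auto
    then have "AE b in lborel. 0 + (1 / a) * b \<notin> N" if "a > 0" for a
      using that by (intro AE_borel_affine) auto
    then have "AE b in lborel. 0 < a \<longrightarrow> b / a \<notin> N" for a
      by (cases "a > 0") auto
    then show "AE a in lborel. AE b in lborel. 0 < fst (a, b) \<longrightarrow> snd (a, b) / fst (a, b) \<notin> N"
      by simp
  qed
  then have "AE p in (lborel :: (real \<times> real) measure). fst p > 0 \<longrightarrow> snd p / fst p \<notin> N"
    unfolding lborel_prod .
  then have "AE p in (lborel :: (real \<times> real) measure). fst p > 0 \<longrightarrow> P (snd p / fst p)"
  proof eventually_elim
    case (elim p)
    then show ?case
      using N(2) by blast
  qed
  then show ?thesis
    by (rule AE_completion)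
qed

section \<open>The orbit of a point\<close>

locale bcz_orbit =
  fixes a b :: real
  assumes in_triangle: "(a, b) \<in> bcz_triangle"
begin

definition x :: "nat \<Rightarrow> real" where
  "x n = fst ((bcz_map ^^ n) (a, b))"

text \<open>Here \<open>k n\<close> is the paper's \<open>k\<^sub>n\<^sub>+\<^sub>1\<close>.\<close>

definition k :: "nat \<Rightarrow> int" where
  "k n = bcz_k ((bcz_map ^^ n) (a, b))"

definition f :: "nat \<Rightarrow> int" where
  "f n = (\<Sum>i<n. k i - 3)"

text \<open>The initial values of \<open>m\<close> and \<open>q\<close> make
  \<open>q n * (a + b) - m n * a\<close> equal to \<open>a\<close> and \<open>b\<close> at the first
  two indices and give the basis determinant 1. The Euclidean count is applied only from index 1 on,
  where \<open>m\<close> is positive.\<close>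

fun m :: "nat \<Rightarrow> int" where
  "m 0 = -1"
| "m (Suc 0) = 1"
| "m (Suc (Suc n)) = k n * m (Suc n) - m n"

fun q :: "nat \<Rightarrow> int" where
  "q 0 = 0"
| "q (Suc 0) = 1"
| "q (Suc (Suc n)) = k n * q (Suc n) - q n"

declare m.simps(3) [simp del] q.simps(3) [simp del]

definition M :: "nat \<Rightarrow> real" where
  "M n = m n / x n"

lemma ab: "0 < a" "a \<le> 1" "0 < b" "b \<le> 1" "a + b > 1"
  using in_triangle by (auto simp: bcz_triangle_def)

lemma orbit_eq: "(bcz_map ^^ n) (a, b) = (x n, x (Suc n))"
proof -
  have "fst (bcz_map p) = snd p" for p
    by (simp add: bcz_map_def split: prod.split)
  then show ?thesis
    by (simp add: x_def prod_eq_iff)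
qed

lemma orbit_in_triangle: "(x n, x (Suc n)) \<in> bcz_triangle"
proof (induction n)
  case 0
  show ?case
    using in_triangle orbit_eq[of 0] by simp
next
  case (Suc n)
  have "bcz_map (x n, x (Suc n)) = (x (Suc n), x (Suc (Suc n)))"
    using orbit_eq[of n] orbit_eq[of "Suc n"] by simp
  then show ?case
    using bcz_map_in_triangle[OF Suc] by simp
qed

lemma x_0: "x 0 = a" and x_1: "x (Suc 0) = b"
  using orbit_eq[of 0] by simp_all

lemma x_pos: "0 < x n" and x_le_1: "x n \<le> 1" and x_add: "1 < x n + x (Suc n)"
  using orbit_in_triangle[of n] by (auto simp: bcz_triangle_def)

lemma x_rec: "x (Suc (Suc n)) = k n * x (Suc n) - x n"
proof -
  have "bcz_map (x n, x (Suc n)) = (x (Suc n), x (Suc (Suc n)))"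
    using orbit_eq[of n] orbit_eq[of "Suc n"] by simp
  moreover have "k n = \<lfloor>(1 + x n) / x (Suc n)\<rfloor>"
    by (simp only: k_def orbit_eq bcz_k_def prod.case)
  ultimately show ?thesis
    by (simp add: bcz_map_def)
qed

lemma k_pos: "k n \<ge> 1"
proof -
  have "k n * x (Suc n) > 0"
    using x_rec[of n] x_pos[of n] x_pos[of "Suc (Suc n)"] by linarith
  then have "k n > 0"
    using x_pos[of "Suc n"] by (simp add: zero_less_mult_iff)
  then show ?thesis by simp
qed

text \<open>If \<open>x (Suc n) < 1 / 2\<close>, both neighbours exceed \<open>1 / 2\<close>, so
  their sum \<open>k n * x (Suc n)\<close> exceeds 1; otherwise \<open>k n \<ge> 1\<close>
  suffices.\<close>

lemma inverse_x_le: "1 / x (Suc n) \<le> 2 * k n"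
proof (cases "x (Suc n) \<ge> 1 / 2")
  case True
  then have "1 / x (Suc n) \<le> 2"
    using x_pos[of "Suc n"] by (simp add: field_simps)
  moreover have "real_of_int (k n) \<ge> 1"
    using k_pos[of n] by simp
  ultimately show ?thesis by linarith
next
  case False
  then have "1 < k n * x (Suc n)"
    using x_rec[of n] x_add[of n] x_add[of "Suc n"] by linarith
  then have "1 / x (Suc n) \<le> k n"
    using x_pos[of "Suc n"] by (simp add: field_simps)
  then show ?thesis
    using k_pos[of n] by simp
qed

lemma x_eq: "x n = q n * (a + b) - m n * a"
proof (induction n rule: m.induct)
  case (3 n)
  have "x (Suc (Suc n)) = k n * (q (Suc n) * (a + b) - m (Suc n) * a) - (q n * (a + b) - m n * a)"
    unfolding x_rec 3 ..
  then show ?case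
    by (simp add: m.simps(3) q.simps(3) algebra_simps)
qed (simp_all add: x_0 x_1)

lemma det: "m (Suc n) * q n - m n * q (Suc n) = 1"
  by (induction n) (simp_all add: m.simps(3) q.simps(3) algebra_simps)

lemma det_x: "m (Suc n) * x n - m n * x (Suc n) = a + b"
proof -
  have "m (Suc n) * x n - m n * x (Suc n)
      = real_of_int (m (Suc n) * q n - m n * q (Suc n)) * (a + b)"
    by (simp add: x_eq[of n] x_eq[of "Suc n"] algebra_simps)
  then show ?thesis
    by (simp only: det) simp
qed

lemma M_Suc: "M (Suc n) = M n + (a + b) / (x n * x (Suc n))"
  using det_x[of n] x_pos[of n] x_pos[of "Suc n"] by (simp add: M_def field_simps)

lemma M_1: "M (Suc 0) = 1 / b"
  by (simp add: M_def x_1)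

lemma M_less: "M n + 1 < M (Suc n)"
proof -
  have "x n * x (Suc n) \<le> 1"
    using x_pos[of n] x_pos[of "Suc n"] x_le_1 by (intro mult_le_one) (auto simp: less_imp_le)
  then have "1 < (a + b) / (x n * x (Suc n))"
    using ab x_pos[of n] x_pos[of "Suc n"] by (simp add: field_simps)
  then show ?thesis
    by (simp add: M_Suc)
qed

lemma M_ge: "M (Suc n) \<ge> 1 / b + n"
proof (induction n)
  case 0
  then show ?case by (simp add: M_1)
next
  case (Suc n)
  then show ?case
    using M_less[of "Suc n"] by simp
qed

lemma M_ge_1: "M (Suc n) \<ge> 1"
proof -
  have "1 / b \<ge> 1"
    using ab by simp
  then show ?thesis
    using M_ge[of n] by linarith
qed

lemma m_eq: "m n = M n * x n"
  using x_pos[of n] by (simp add: M_def)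

lemma m_pos: "m (Suc n) \<ge> 1"
proof -
  have "real_of_int (m (Suc n)) > 0"
    unfolding m_eq using M_ge_1[of n] x_pos[of "Suc n"] by (intro mult_pos_pos) auto
  then show ?thesis by simp
qed

text \<open>Supplies the hypothesis \<open>n \<ge> 2\<close> of \<open>euclid_balance_step\<close>.
  A later vector with entry 1 would have slope above \<open>1 / b\<close>, hence
  \<open>x < b\<close>; this forces \<open>q \<le> 0\<close> and then a negative value of
  \<open>x\<close>.\<close>

lemma m_ge_2: "m (Suc (Suc n)) \<ge> 2"
proof (rule ccontr)
  let ?n = "Suc (Suc n)"
  assume "\<not> ?thesis"
  then have m1: "m ?n = 1"
    using m_pos[of "Suc n"] by simp
  then have "1 / b < 1 / x ?n"
    using M_ge[of "Suc n"] by (simp add: M_def)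
  then have "x ?n < b"
    using x_pos[of ?n] ab by (simp add: field_simps)
  then have "q ?n * (a + b) < 1 * (a + b)"
    using x_eq[of ?n] m1 by simp
  then have "q ?n \<le> 0"
    using ab by (simp only: mult_less_cancel_right_pos)
  then have "q ?n * (a + b) \<le> 0"
    using ab by (intro mult_nonpos_nonneg) auto
  then show False
    using x_eq[of ?n] x_pos[of ?n] m1 ab by simp
qed

lemma coprime_m: "coprime (m n) (m (Suc n))"
proof (rule coprimeI)
  fix d assume "d dvd m n" "d dvd m (Suc n)"
  then have "d dvd m (Suc n) * q n - m n * q (Suc n)"
    by simp
  then show "is_unit d"
    by (simp only: det)
qed

text \<open>Telescopes \<open>euclid_balance_step\<close>. The constant comes from the first term:
  the balance of \<open>(1, k 0 + 1)\<close> is the full \<open>k 0\<close>, whereas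
  \<open>f\<close> counts \<open>k 0 - 3\<close>.\<close>

lemma f_eq: "f (Suc n) = euclid_balance (m (Suc n)) (m (Suc (Suc n))) - 3"
proof (induction n)
  case 0
  have "euclid_balance 1 (1 + k 0 * 1) = euclid_balance 1 1 + k 0"
    using k_pos[of 0] by (intro euclid_balance_add_mult_right) auto
  then show ?case
    by (simp add: f_def m.simps(3) euclid_balance.simps[of 1 1] add.commute)
next
  case (Suc n)
  let ?n = "Suc n"
  have "euclid_balance (m (Suc ?n)) (k ?n * m (Suc ?n) - m ?n)
      = euclid_balance (m ?n) (m (Suc ?n)) + k ?n - 3"
  proof (rule euclid_balance_step[OF coprime_m])
    show "m (Suc n) > 0" "m (Suc ?n) \<ge> 2"
      using m_pos[of n] m_ge_2[of n] by auto
    show "k ?n * m (Suc ?n) - m ?n > 0"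
      using m_pos[of "Suc ?n"] by (simp add: m.simps(3))
  qed
  then show ?case
    using Suc by (simp add: f_def m.simps(3)[of ?n])
qed

text \<open>Shows that the slope grows at most linearly once \<open>f\<close> and
  \<open>1 / x\<close> are of lower order. By \<open>a + b \<le> 2\<close> and
  \<open>u + v > 1\<close> each increment is at most \<open>2 / u + 2 / v\<close>. Every inner
  coordinate is thus charged \<open>4 / u \<le> 8 * k\<close>, and the sum of the \<open>k\<close>
  is \<open>f n + 3 * n\<close>; the last \<open>2 / x\<close> is still uncharged.\<close>

lemma M_le_sum: "M (Suc n) \<le> 1 / b + 8 * f n + 24 * n + 2 / x (Suc n)"
proof (induction n)
  case 0
  then show ?case
    using ab by (simp add: M_1 f_def x_1 divide_right_mono)
next
  case (Suc n)
  let ?u = "x (Suc n)" and ?v = "x (Suc (Suc n))"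
  have pos: "?u > 0" "?v > 0"
    using x_pos by auto
  have "(a + b) * 1 \<le> 2 * (?u + ?v)"
    using ab x_add[of "Suc n"] by (intro mult_mono) auto
  then have "(a + b) / (?u * ?v) \<le> 2 * (?u + ?v) / (?u * ?v)"
    using pos by (intro divide_right_mono) auto
  also have "\<dots> = 2 / ?u + 2 / ?v"
    using pos by (simp add: field_simps)
  finally have "M (Suc (Suc n)) \<le> M (Suc n) + 2 / ?u + 2 / ?v"
    by (simp add: M_Suc[of "Suc n"])
  moreover have "f (Suc n) = f n + k n - 3"
    by (simp add: f_def)
  moreover have "2 / ?u \<le> 4 * k n"
    using inverse_x_le[of n] by simp
  ultimately show ?case
    using Suc by simp
qed

section \<open>Upper bound for \<open>f\<close> from Diophantine approximation\<close>

context
  fixes c \<epsilon> :: real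
  assumes \<epsilon>: "0 < \<epsilon>" "\<epsilon> \<le> 1" and c: "0 < c" "c \<le> 1"
    and dioph: "\<And>(q::int) (t::int). t \<ge> (1::int) \<Longrightarrow> c * t powr (- 1 - \<epsilon>) \<le> \<bar>q * (a + b) - t * a\<bar>"
begin

text \<open>The interior vector is the sum of two consecutive orbit vectors, so
  \<open>i = j = 1\<close>; its slope is a mediant and at most the later slope. Both entries are at
  most that slope too, whence the factor 2 on the logarithm.\<close>

lemma f_le_log: "\<bar>real_of_int (f (Suc n))\<bar>
  \<le> 3 + 16 / c * M (Suc (Suc n)) powr ((1 + \<epsilon>) / 2) * log 2 (M (Suc (Suc n)))"
proof -
  let ?u = "Suc n" and ?v = "Suc (Suc n)"
  define N where "N = real_of_int (m ?u) + m ?v"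
  define X where "X = x ?u + x ?v"
  have m1: "m ?u \<ge> 1" "m ?v \<ge> 1"
    using m_pos by auto
  then have mr: "real_of_int (m ?u) \<ge> 1" "real_of_int (m ?v) \<ge> 1"
    by simp_all
  have X: "0 < X" "X \<le> 2"
    using x_pos[of ?u] x_pos[of ?v] x_le_1[of ?u] x_le_1[of ?v] by (auto simp: X_def)
  have "\<bar>real_of_int (euclid_balance (m ?u) (m ?v))\<bar>
           \<le> 8 / c * (N / X) powr ((1 + \<epsilon>) / 2) * log 2 (m ?u * m ?v)"
  proof (rule euclid_balance_bound[OF c \<epsilon>, where a = a and \<sigma> = "a + b" and q = "q ?u" and l = "q ?v"
        and i = 1 and j = 1])
    show "X = 1 * (q ?u * (a + b) - m ?u * a) + 1 * (q ?v * (a + b) - m ?v * a)"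
      unfolding X_def by (simp only: x_eq) simp
    show "m ?v * q ?u - m ?u * q ?v = 1"
      by (rule det)
  qed (use ab m1 X dioph in \<open>auto simp: N_def\<close>)
  also have "\<dots> \<le> 8 / c * M ?v powr ((1 + \<epsilon>) / 2) * (2 * log 2 (M ?v))"
  proof (intro mult_mono powr_mono2)
    have "M ?u \<le> M ?v"
      using M_less[of ?u] by simp
    then have "m ?u \<le> M ?v * x ?u"
      unfolding m_eq using x_pos[of ?u] by (intro mult_right_mono) auto
    then have "N \<le> M ?v * X"
      unfolding N_def X_def by (simp add: m_eq[of ?v] algebra_simps)
    then show "N / X \<le> M ?v"
      using X by (simp add: field_simps)
    have le: "m i \<le> M i" if "M i \<ge> 1" for i
      using mult_left_mono[OF x_le_1[of i], of "M i"] that by (simp add: m_eq)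
    have "m ?u \<le> M ?v" "m ?v \<le> M ?v"
      using le[OF M_ge_1[of n]] le[OF M_ge_1[of ?u]] \<open>M ?u \<le> M ?v\<close> by linarith+
    then have "m ?u * m ?v \<le> M ?v * M ?v"
      using mr unfolding of_int_mult by (intro mult_mono) auto
    moreover have "real_of_int (m ?u * m ?v) > 0"
      using m1 by simp
    ultimately have "log 2 (m ?u * m ?v) \<le> log 2 (M ?v * M ?v)"
      by simp
    also have "\<dots> = 2 * log 2 (M ?v)"
      using M_ge_1[of "Suc n"] by (simp add: log_mult)
    finally show "log 2 (m ?u * m ?v) \<le> 2 * log 2 (M ?v)" .
    have "real_of_int (m ?u * m ?v) \<ge> 1"
      using mr mult_mono[of 1 "real_of_int (m ?u)" 1 "real_of_int (m ?v)"] by simp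
    then show "0 \<le> log 2 (m ?u * m ?v)"
      by simp
    show "0 \<le> N / X"
      using mr X by (simp add: N_def)
  qed (use c \<epsilon> in auto)
  finally show ?thesis
    by (simp add: f_eq)
qed

text \<open>With \<open>m = M * x\<close> and \<open>x \<le> 1\<close> the Diophantine bound becomes
  \<open>c \<le> (x * P)\<^sup>2\<close>, where \<open>P\<close> is the stated power of
  \<open>M\<close>; then \<open>c\<^sup>2 \<le> c\<close> allows taking roots.\<close>

lemma inverse_x_le_M: "1 / x (Suc n) \<le> 1 / c * M (Suc n) powr ((1 + \<epsilon>) / 2)"
proof -
  let ?n = "Suc n"
  have pos: "x ?n > 0" "M ?n \<ge> 1" "m ?n \<ge> 1"
    using x_pos M_ge_1 m_pos by auto
  define P where "P = M ?n powr ((1 + \<epsilon>) / 2)"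
  have "m ?n powr (- 1 - \<epsilon>) * m ?n powr (1 + \<epsilon>) = 1"
    using pos by (simp flip: powr_add)
  then have "c = c * m ?n powr (- 1 - \<epsilon>) * m ?n powr (1 + \<epsilon>)"
    by simp
  also have "\<dots> \<le> x ?n * m ?n powr (1 + \<epsilon>)"
    using dioph[OF pos(3), of "q ?n"] pos by (intro mult_right_mono) (auto simp flip: x_eq)
  also have "\<dots> = x ?n * (M ?n powr (1 + \<epsilon>) * x ?n powr (1 + \<epsilon>))"
    using pos by (simp add: m_eq powr_mult)
  also have "\<dots> \<le> x ?n * (M ?n powr (1 + \<epsilon>) * x ?n powr 1)"
    using pos \<epsilon> x_le_1[of ?n] by (intro mult_left_mono powr_mono') auto
  also have "\<dots> = (x ?n * P)\<^sup>2"
    using pos by (simp add: P_def power2_eq_square flip: powr_add)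
  finally have "c * c \<le> (x ?n * P)\<^sup>2 * 1"
    using c by (intro mult_mono) auto
  then have "c\<^sup>2 \<le> (x ?n * P)\<^sup>2"
    by (simp add: power2_eq_square)
  then have "c \<le> x ?n * P"
    using pos by (intro power2_le_imp_le[of c]) (auto simp: P_def)
  then show ?thesis
    using pos c by (simp add: P_def field_simps)
qed

lemma f_and_inverse_x_bound:
  "\<exists>C>0. \<forall>n. \<bar>real_of_int (f (Suc n))\<bar> \<le> C * M (Suc (Suc n)) powr (1 / 2 + \<epsilon>) \<and>
    1 / x (Suc (Suc n)) \<le> C * M (Suc (Suc n)) powr (1 / 2 + \<epsilon>)"
proof -
  \<comment> \<open>The summands serve the additive 3, the logarithm, which costs
    \<open>\<epsilon> / 2\<close> in the exponent, and the bound on \<open>1 / x\<close>.\<close>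
  define C where "C = 3 + 16 / c * (1 / (\<epsilon> / 2 * ln 2)) + 1 / c"
  have "C > 0"
    using c \<epsilon> by (auto simp: C_def intro!: add_pos_pos)
  moreover have "\<bar>real_of_int (f (Suc n))\<bar> \<le> C * M (Suc (Suc n)) powr (1 / 2 + \<epsilon>) \<and>
    1 / x (Suc (Suc n)) \<le> C * M (Suc (Suc n)) powr (1 / 2 + \<epsilon>)" for n
  proof -
    define W where "W = M (Suc (Suc n))"
    have W: "W \<ge> 1"
      unfolding W_def by (rule M_ge_1)
    have "ln W \<le> W powr (\<epsilon> / 2) / (\<epsilon> / 2)"
      using W \<epsilon> by (intro ln_powr_bound) auto
    then have "log 2 W \<le> W powr (\<epsilon> / 2) / (\<epsilon> / 2) / ln 2"
      unfolding log_def by (intro divide_right_mono) auto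
    also have "\<dots> = 1 / (\<epsilon> / 2 * ln 2) * W powr (\<epsilon> / 2)"
      by simp
    finally have "16 / c * W powr ((1 + \<epsilon>) / 2) * log 2 W
        \<le> 16 / c * W powr ((1 + \<epsilon>) / 2) * (1 / (\<epsilon> / 2 * ln 2) * W powr (\<epsilon> / 2))"
      using c by (intro mult_left_mono) auto
    also have "\<dots> = 16 / c * (1 / (\<epsilon> / 2 * ln 2)) * (W powr ((1 + \<epsilon>) / 2) * W powr (\<epsilon> / 2))"
      by simp
    also have "W powr ((1 + \<epsilon>) / 2) * W powr (\<epsilon> / 2) = W powr (1 / 2 + \<epsilon>)"
      by (simp add: field_simps flip: powr_add)
    finally have 1: "16 / c * W powr ((1 + \<epsilon>) / 2) * log 2 W
        \<le> 16 / c * (1 / (\<epsilon> / 2 * ln 2)) * W powr (1 / 2 + \<epsilon>)" .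
    have 2: "1 / c * W powr ((1 + \<epsilon>) / 2) \<le> 1 / c * W powr (1 / 2 + \<epsilon>)"
      using W \<epsilon> c by (intro mult_left_mono powr_mono) (auto simp: field_simps)
    have 3: "1 \<le> W powr (1 / 2 + \<epsilon>)"
      using W \<epsilon> by (intro ge_one_powr_ge_zero) auto
    have 4: "0 \<le> 16 / c * (1 / (\<epsilon> / 2 * ln 2)) * W powr (1 / 2 + \<epsilon>)" "0 \<le> 1 / c * W powr (1 / 2 + \<epsilon>)"
      using c \<epsilon> by auto
    have "C * W powr (1 / 2 + \<epsilon>) = 3 * W powr (1 / 2 + \<epsilon>)
        + 16 / c * (1 / (\<epsilon> / 2 * ln 2)) * W powr (1 / 2 + \<epsilon>) + 1 / c * W powr (1 / 2 + \<epsilon>)"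
      unfolding C_def by (simp only: distrib_right)
    then show ?thesis
      using 1 2 3 4 f_le_log[of n] inverse_x_le_M[of "Suc n"] unfolding W_def by linarith
  qed
  ultimately show ?thesis by blast
qed

end

lemma filterlim_M: "filterlim (\<lambda>n. M (Suc n)) at_top sequentially"
proof (rule filterlim_at_top_mono)
  show "filterlim real at_top sequentially"
    by (rule filterlim_real_sequentially)
  show "\<forall>\<^sub>F n in sequentially. real n \<le> M (Suc n)"
  proof (rule always_eventually, rule allI)
    fix n
    have "1 / b > 0"
      using ab by simp
    then show "real n \<le> M (Suc n)"
      using M_ge[of n] by linarith
  qed
qed

text \<open>A bootstrap: a crude exponent below 1 already makes the slope linear in
  \<open>n\<close>, after which a small \<open>\<epsilon>\<close> converts the sharp bound in
  \<open>M\<close> into one in \<open>n\<close>.\<close>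

lemma f_upper:
  assumes "almost_badly_approximable (a / (a + b))" and \<delta>: "\<delta> > 0"
  shows "\<forall>\<^sub>F n in sequentially. \<bar>real_of_int (f n)\<bar> \<le> real n powr (1 / 2 + \<delta>)"
proof -
  \<comment> \<open>Multiplying by \<open>a + b > 1\<close> only enlarges the distance, so the
    constant survives after being cut down to at most 1.\<close>
  have dioph: "\<exists>c>0. c \<le> 1 \<and> (\<forall>t\<ge>1::int. \<forall>q::int.
      c * of_int t powr (- 1 - \<epsilon>) \<le> \<bar>of_int q * (a + b) - of_int t * a\<bar>)" if \<epsilon>: "\<epsilon> > 0" for \<epsilon>
  proof -
    obtain c where c: "c > 0" "\<And>t p::int. t \<ge> (1::int) \<Longrightarrow>
        c * of_int t powr (- 1 - \<epsilon>) \<le> \<bar>of_int t * (a / (a + b)) - of_int p\<bar>"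
      using assms(1) \<epsilon> unfolding almost_badly_approximable_def by metis
    have "min c 1 * t powr (- 1 - \<epsilon>) \<le> \<bar>q * (a + b) - t * a\<bar>" if "t \<ge> 1" for t q :: int
    proof -
      have "min c 1 * t powr (- 1 - \<epsilon>) \<le> c * t powr (- 1 - \<epsilon>)"
        by (intro mult_right_mono) auto
      also have "\<dots> \<le> \<bar>t * (a / (a + b)) - q\<bar>"
        using c(2) that .
      also have "\<dots> \<le> (a + b) * \<bar>t * (a / (a + b)) - q\<bar>"
        using ab mult_right_mono[of 1 "a + b" "\<bar>t * (a / (a + b)) - q\<bar>"] by simp
      also have "\<dots> = \<bar>(a + b) * (t * (a / (a + b)) - q)\<bar>"
        using ab by (simp add: abs_mult)
      also have "(a + b) * (t * (a / (a + b)) - q) = - (q * (a + b) - t * a)"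
        using ab by (simp add: field_simps)
      finally show ?thesis by simp
    qed
    then show ?thesis
      using c by (intro exI[of _ "min c 1"]) auto
  qed
  have bound: "\<exists>C>0. \<forall>n. \<bar>real_of_int (f (Suc n))\<bar> \<le> C * M (Suc (Suc n)) powr (1 / 2 + \<epsilon>) \<and>
    1 / x (Suc (Suc n)) \<le> C * M (Suc (Suc n)) powr (1 / 2 + \<epsilon>)" if \<epsilon>: "\<epsilon> > 0" "\<epsilon> \<le> 1" for \<epsilon>
  proof -
    obtain c where c: "c > 0" "c \<le> 1" "\<And>t q::int. t \<ge> (1::int) \<Longrightarrow>
        c * of_int t powr (- 1 - \<epsilon>) \<le> \<bar>of_int q * (a + b) - of_int t * a\<bar>"
      using dioph[OF \<epsilon>(1)] by metis
    show ?thesis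
      by (rule f_and_inverse_x_bound[OF \<epsilon> c(1,2)]) (rule c(3))
  qed
  have limM: "filterlim (\<lambda>n. M (Suc (Suc n))) at_top sequentially"
    by (rule filterlim_compose[OF filterlim_M filterlim_Suc])
  obtain C where C: "C > 0" "\<And>n. \<bar>real_of_int (f (Suc n))\<bar> \<le> C * M (Suc (Suc n)) powr (3 / 4)"
    "\<And>n. 1 / x (Suc (Suc n)) \<le> C * M (Suc (Suc n)) powr (3 / 4)"
    using bound[of "1 / 4"] by auto
  \<comment> \<open>The factor 10 collects the 8 before \<open>f\<close> and the 2 before
    \<open>1 / x\<close> in \<open>M_le_sum\<close>; absorbing half of \<open>M\<close> turns 24
    into 48.\<close>
  have "\<forall>\<^sub>F w :: real in at_top. 1 / b + 10 * C * w powr (3 / 4) \<le> w / 2"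
    by real_asymp
  then have "\<forall>\<^sub>F n in sequentially.
      1 / b + 10 * C * M (Suc (Suc n)) powr (3 / 4) \<le> M (Suc (Suc n)) / 2"
    by (rule eventually_compose_filterlim[OF _ limM])
  then have "\<forall>\<^sub>F n in sequentially. M (Suc (Suc n)) \<le> 48 * (real n + 1)"
  proof eventually_elim
    case (elim n)
    moreover have "M (Suc (Suc n)) \<le> 1 / b + 8 * f (Suc n) + 24 * (real n + 1) + 2 / x (Suc (Suc n))"
      using M_le_sum[of "Suc n"] by (simp add: add.commute)
    moreover have "2 / x (Suc (Suc n)) \<le> 2 * (C * M (Suc (Suc n)) powr (3 / 4))"
      using C(3)[of n] by simp
    ultimately show ?case
      using C(2)[of n] by linarith
  qed
  moreover
  define \<epsilon> where "\<epsilon> = min (\<delta> / 2) 1"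
  have \<epsilon>: "\<epsilon> > 0" "\<epsilon> \<le> 1" "\<epsilon> < \<delta>"
    using \<delta> by (auto simp: \<epsilon>_def min_def)
  obtain D where D: "D > 0" "\<And>n. \<bar>real_of_int (f (Suc n))\<bar> \<le> D * M (Suc (Suc n)) powr (1 / 2 + \<epsilon>)"
    using bound[OF \<epsilon>(1,2)] by blast
  have "\<forall>\<^sub>F n in sequentially. D * (48 * (real n + 1)) powr (1 / 2 + \<epsilon>) \<le> (real n + 1) powr (1 / 2 + \<delta>)"
    using D(1) \<epsilon> by real_asymp
  ultimately have "\<forall>\<^sub>F n in sequentially. \<bar>real_of_int (f (Suc n))\<bar> \<le> real (Suc n) powr (1 / 2 + \<delta>)"
  proof eventually_elim
    case (elim n)
    have "\<bar>real_of_int (f (Suc n))\<bar> \<le> D * M (Suc (Suc n)) powr (1 / 2 + \<epsilon>)"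
      by (rule D)
    also have "\<dots> \<le> D * (48 * (real n + 1)) powr (1 / 2 + \<epsilon>)"
      using elim(1) D \<epsilon> M_ge_1[of "Suc n"] by (intro mult_left_mono powr_mono2) auto
    finally show ?case
      using elim(2) by (simp add: add.commute)
  qed
  then show ?thesis
    using eventually_sequentially_Suc[of "\<lambda>n. \<bar>real_of_int (f n)\<bar> \<le> real n powr (1 / 2 + \<delta>)"] by simp
qed

section \<open>Lower bound for \<open>f\<close> from one-sided approximations\<close>

text \<open>The slope \<open>t / L\<close> falls between two consecutive slopes of the orbit. In the
  basis of these two vectors the coefficients are \<open>e \<ge> 1\<close> and
  \<open>d \<ge> 0\<close>, and positivity of the form leaves \<open>x n \<le> L\<close>.\<close>

lemma orbit_complete:
  fixes t u :: int
  defines "L \<equiv> u * (a + b) - t * a"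
  assumes t: "t \<ge> 1" and L: "0 < L" "L \<le> 1"
  obtains n where "x (Suc n) \<le> L" "M (Suc n) \<le> t / L"
proof -
  \<comment> \<open>Otherwise \<open>L\<close> would be at least \<open>t * b + a + b > 1\<close>.
    From \<open>u \<le> t\<close> follows \<open>L \<le> t * b\<close>, so the slope is not below
    that of the first vector.\<close>
  have "u \<le> t"
  proof (rule ccontr)
    assume "\<not> u \<le> t"
    then have "(real_of_int t + 1) * (a + b) \<le> u * (a + b)"
      using ab by (intro mult_right_mono) auto
    moreover have "t * b > 0"
      using t ab by simp
    ultimately show False
      using L ab unfolding L_def by (simp add: algebra_simps)
  qed
  then have "u * (a + b) \<le> t * (a + b)"
    using ab by (intro mult_right_mono) auto
  then have "1 / b \<le> t / L"
    using L ab by (simp add: L_def field_simps)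
  define n where "n = (LEAST n. t / L < M (Suc n))"
  obtain n0 where "t / L < M (Suc n0)"
    using filterlim_M unfolding filterlim_at_top_dense eventually_sequentially by blast
  then have n: "t / L < M (Suc n)"
    unfolding n_def by (rule LeastI)
  have "n \<noteq> 0"
  proof
    assume "n = 0"
    then show False
      using n \<open>1 / b \<le> t / L\<close> M_1 by simp
  qed
  then obtain i where i: "n = Suc i"
    by (cases n) auto
  have Mi: "M (Suc i) \<le> t / L"
    using not_less_Least[of i "\<lambda>n. t / L < M (Suc n)"] i by (simp add: n_def)
  \<comment> \<open>The coefficients by Cramer's rule; the strict slope inequality and integrality
    give \<open>e \<ge> 1\<close>.\<close>
  define d e where "d = t * q (Suc i) - m (Suc i) * u" and "e = m (Suc n) * u - t * q (Suc n)"
  have detL: "t * x j - m j * L = (a + b) * (t * q j - m j * u)" for j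
    by (simp add: x_eq[of j] L_def algebra_simps)
  have "0 \<le> t * x (Suc i) - m (Suc i) * L"
    using Mi L x_pos[of "Suc i"] by (simp add: M_def field_simps)
  then have d: "d \<ge> 0"
    using ab unfolding detL by (simp add: zero_le_mult_iff d_def flip: of_int_mult of_int_diff)
  have "t * x (Suc n) - m (Suc n) * L < 0"
    using n L x_pos[of "Suc n"] by (simp add: M_def field_simps)
  then have e: "e \<ge> 1"
    using ab unfolding detL by (simp add: mult_less_0_iff e_def flip: of_int_mult of_int_diff)
  have "L * real_of_int (m (Suc n) * q n - m n * q (Suc n)) = e * x n + d * x (Suc n)"
    unfolding x_eq d_def e_def L_def i by (simp add: algebra_simps)
  then have L_eq: "L = e * x n + d * x (Suc n)"
    unfolding det by simp
  have ex: "x n \<le> e * x n"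
    using e x_pos[of n] mult_right_mono[of 1 "real_of_int e" "x n"] by simp
  have "0 \<le> d * x (Suc n)"
    using d x_pos[of "Suc n"] by simp
  then have "x n \<le> L"
    using L_eq ex by linarith
  then show thesis
    using that[of i] Mi i by simp
qed

text \<open>A one-sided approximation has a form value \<open>L\<close> with
  \<open>t * L \<le> 2\<close>. The orbit vector found for it satisfies
  \<open>1 / L \<le> 2 * k n\<close> and
  \<open>n \<le> t / L = t * L * (1 / L)\<^sup>2\<close>.\<close>

lemma k_large:
  assumes "a / (a + b) \<notin> \<rat>"
  shows "\<exists>n. K \<le> real_of_int (k n) \<and> real n \<le> 8 * (real_of_int (k n))\<^sup>2"
proof -
  \<comment> \<open>The factor 4 combines \<open>N / 2 \<le> 1 / L\<close> with
    \<open>1 / L \<le> 2 * k n\<close>.\<close>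
  define N where "N = nat \<lceil>max 1 K\<rceil> * 4"
  have N: "N > 0" "real N \<ge> 4 * K" "N \<ge> 2"
    unfolding N_def by linarith+
  \<comment> \<open>Positive values of \<open>u * (a + b) - t * a\<close> at \<open>t > 0\<close>
    are approximations of \<open>- (a / (a + b))\<close> from below, with
    \<open>u = - p\<close>.\<close>
  have "- (a / (a + b)) \<notin> \<rat>"
    using assms by simp
  then obtain p t :: int where t: "t > 0" and p: "0 < t * - (a / (a + b)) - p"
    "t * - (a / (a + b)) - p < 1 / N" "t * (t * - (a / (a + b)) - p) < 1"
    using one_sided_Dirichlet_approx[OF _ N(1)] by blast
  define L where "L = of_int (- p) * (a + b) - t * a"
  have L_eq: "L = (a + b) * (t * - (a / (a + b)) - p)"
    using ab by (simp add: L_def field_simps)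
  have "L > 0"
    unfolding L_eq using ab p by (intro mult_pos_pos) auto
  have "L \<le> 2 * (1 / N)"
    unfolding L_eq using ab p by (intro mult_mono) auto
  have "t * L = (a + b) * (t * (t * - (a / (a + b)) - p))"
    unfolding L_eq by simp
  also have "\<dots> \<le> 2 * 1"
    using ab p t by (intro mult_mono) auto
  finally have tL: "t * L \<le> 2" by simp
  have "2 * (1 / real N) \<le> 1"
    using N by (simp add: field_simps)
  then have "L \<le> 1"
    using \<open>L \<le> 2 * (1 / N)\<close> by linarith
  obtain n where n: "x (Suc n) \<le> L" "M (Suc n) \<le> t / L"
    using orbit_complete[of t "- p"] t \<open>L > 0\<close> \<open>L \<le> 1\<close> unfolding L_def by auto
  have "1 / L \<le> 1 / x (Suc n)"
    using n x_pos[of "Suc n"] \<open>L > 0\<close> by (simp add: frac_le)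
  then have kL: "1 / L \<le> 2 * real_of_int (k n)"
    using inverse_x_le[of n] by linarith
  have "1 / b > 0"
    using ab by simp
  then have "real n \<le> t / L"
    using M_ge[of n] n(2) by linarith
  also have "\<dots> = t * L * (1 / L)\<^sup>2"
    using \<open>L > 0\<close> by (simp add: power2_eq_square)
  also have "\<dots> \<le> 2 * (2 * real_of_int (k n))\<^sup>2"
    using tL kL t \<open>L > 0\<close> by (intro mult_mono power_mono) auto
  finally have "real n \<le> 8 * (real_of_int (k n))\<^sup>2"
    by simp
  moreover have "N / 2 \<le> 1 / L"
    using \<open>L \<le> 2 * (1 / N)\<close> \<open>L > 0\<close> N by (simp add: field_simps)
  then have "K \<le> k n"
    using kL N by linarith
  ultimately show ?thesis by blast
qed

text \<open>As \<open>k n - 3\<close> is the difference of \<open>f (Suc n)\<close> and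
  \<open>f n\<close>, a \<open>k n\<close> of order at least the square root of \<open>n\<close>
  prevents both from staying below a power with exponent \<open>y < 1 / 2\<close>.\<close>

lemma f_lower:
  assumes irr: "a / (a + b) \<notin> \<rat>" and y: "0 < y" "y < 1 / 2"
  shows "\<exists>\<^sub>F n in sequentially. real n powr y < \<bar>real_of_int (f n)\<bar>"
proof (rule ccontr)
  assume "\<not> ?thesis"
  then obtain n0 where n0: "\<And>n. n \<ge> n0 \<Longrightarrow> \<bar>real_of_int (f n)\<bar> \<le> real n powr y"
    by (auto simp: frequently_def eventually_sequentially not_less)
  have "\<forall>\<^sub>F w :: real in at_top. 3 + 2 * (8 * w\<^sup>2 + 1) powr y < w"
    using y by real_asymp
  then obtain w0 where w0: "\<And>w. w \<ge> w0 \<Longrightarrow> 3 + 2 * (8 * w\<^sup>2 + 1) powr y < w"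
    by (auto simp: eventually_at_top_linorder)
  \<comment> \<open>Exceeding every \<open>k n\<close> with \<open>n < n0\<close> places the index
    found next at or beyond \<open>n0\<close>; from \<open>w0\<close> on the power comparison
    holds.\<close>
  define K where "K = max w0 (Max (insert 0 ((\<lambda>n. real_of_int (k n)) ` {..<n0})) + 1)"
  obtain n where n: "K \<le> real_of_int (k n)" "real n \<le> 8 * (real_of_int (k n))\<^sup>2"
    using k_large[OF irr] by blast
  have "\<not> n < n0"
  proof
    assume "n < n0"
    then have "real_of_int (k n) \<le> Max (insert 0 ((\<lambda>n. real_of_int (k n)) ` {..<n0}))"
      by (intro Max_ge) auto
    then show False
      using n(1) by (simp add: K_def)
  qed
  then have "\<bar>real_of_int (f n)\<bar> \<le> real n powr y" "\<bar>real_of_int (f (Suc n))\<bar> \<le> real (Suc n) powr y"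
    by (auto intro: n0 simp del: of_nat_Suc)
  moreover have "real n powr y \<le> (8 * (real_of_int (k n))\<^sup>2 + 1) powr y"
    "real (Suc n) powr y \<le> (8 * (real_of_int (k n))\<^sup>2 + 1) powr y"
    using n y by (auto intro!: powr_mono2)
  moreover have "real_of_int (k n) = real_of_int (f (Suc n)) - f n + 3"
    by (simp add: f_def)
  moreover have "3 + 2 * (8 * (real_of_int (k n))\<^sup>2 + 1) powr y < k n"
    using n(1) by (intro w0) (simp add: K_def)
  ultimately show False
    by linarith
qed

end

section \<open>Growth exponents\<close>

lemma elog_div_ln_le_iff:
  assumes "n \<ge> 2" "x \<ge> 0"
  shows "elog x / ereal (ln (real n)) \<le> ereal y \<longleftrightarrow> x \<le> real n powr y"
proof (cases "x = 0")
  case True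
  \<comment> \<open>Here \<open>elog x\<close> is \<open>- \<infinity>\<close> and remains so after
    division by the positive logarithm, so both sides hold.\<close>
  then show ?thesis
    using assms by (simp add: elog_def divide_ereal_def)
next
  case False
  have ln: "ln (real n) > 0"
    using assms by simp
  have "elog x / ereal (ln (real n)) \<le> ereal y \<longleftrightarrow> ln x \<le> y * ln (real n)"
    using False ln by (simp add: elog_def field_simps)
  also have "y * ln (real n) = ln (real n powr y)"
    using assms by (simp add: ln_powr)
  also have "ln x \<le> ln (real n powr y) \<longleftrightarrow> x \<le> real n powr y"
    using False assms by (intro ln_le_cancel_iff) auto
  finally show ?thesis .
qed

lemma limsup_elog_eq_half:
  fixes g :: "nat \<Rightarrow> real"
  assumes nonneg: "\<And>n. g n \<ge> 0"
    and upper: "\<And>\<delta>. \<delta> > 0 \<Longrightarrow> \<forall>\<^sub>F n in sequentially. g n \<le> real n powr (1 / 2 + \<delta>)"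
    and lower: "\<And>y. 0 < y \<Longrightarrow> y < 1 / 2 \<Longrightarrow> \<exists>\<^sub>F n in sequentially. real n powr y < g n"
  shows "limsup (\<lambda>n. elog (g n) / ereal (ln (real n))) = ereal (1 / 2)" (is "?L = _")
proof (rule antisym)
  show "?L \<le> ereal (1 / 2)"
  proof (rule ereal_le_epsilon2)
    fix \<delta> :: real assume "\<delta> > 0"
    have "\<forall>\<^sub>F n in sequentially. elog (g n) / ereal (ln (real n)) \<le> ereal (1 / 2 + \<delta>)"
      using upper[OF \<open>\<delta> > 0\<close>] eventually_ge_at_top[of 2]
      by eventually_elim (simp only: elog_div_ln_le_iff nonneg)
    then show "?L \<le> ereal (1 / 2) + ereal \<delta>"
      by (simp add: Limsup_bounded)
  qed
  show "ereal (1 / 2) \<le> ?L"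
  proof (rule ccontr)
    assume "\<not> ?thesis"
    \<comment> \<open>The maximum with 0 makes the intermediate \<open>y\<close> positive, as
      \<open>lower\<close> requires.\<close>
    then have "max ?L 0 < ereal (1 / 2)"
      by simp
    then obtain y where y: "max ?L 0 < ereal y" "ereal y < ereal (1 / 2)"
      using ereal_dense2 by blast
    have "\<forall>\<^sub>F n in sequentially. elog (g n) / ereal (ln (real n)) < ereal y"
      using y by (intro Limsup_lessD) simp
    then have "\<forall>\<^sub>F n in sequentially. g n \<le> real n powr y"
      using eventually_ge_at_top[of 2]
      by eventually_elim (simp only: less_imp_le flip: elog_div_ln_le_iff[OF _ nonneg])
    moreover have "\<exists>\<^sub>F n in sequentially. real n powr y < g n"
      using y by (intro lower) auto
    ultimately show False
      by (simp add: frequently_def not_less)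
  qed
qed

section \<open>Transfer of almost bad approximability from \<open>b / a\<close> to the ratios of the
  orbit\<close>

text \<open>Up to sign and the factor \<open>1 + s\<close>, the error of \<open>q / t\<close> for
  \<open>1 / (1 + s)\<close> is that of \<open>(t - q) / q\<close> for \<open>s\<close>, so
  \<open>q\<close> becomes the denominator. It is comparable to \<open>t\<close> when
  \<open>1 \<le> q \<le> 2 * t\<close>; otherwise the error \<open>q * s - (t - q)\<close> has size
  at least 1. The two cases give the two entries of \<open>C\<close>.\<close>

lemma almost_badly_approximable_inverse:
  assumes s: "s > 0" "almost_badly_approximable s"
  shows "almost_badly_approximable (1 / (1 + s))"
  unfolding almost_badly_approximable_def
proof (intro allI impI)
  fix \<epsilon> :: real assume \<epsilon>: "\<epsilon> > 0"
  then obtain c where c: "c > 0"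
    "\<And>q p :: int. q \<ge> (1::int) \<Longrightarrow> c * of_int q powr (- 1 - \<epsilon>) \<le> \<bar>of_int q * s - of_int p\<bar>"
    using s(2) unfolding almost_badly_approximable_def by metis
  define C where "C = min (1 / (1 + s)) (c * 2 powr (- 1 - \<epsilon>) / (1 + s))"
  have "C > 0"
    using c s by (simp add: C_def)
  moreover have "C * of_int t powr (- 1 - \<epsilon>) \<le> \<bar>of_int t * (1 / (1 + s)) - of_int q\<bar>"
    if "t \<ge> 1" for t q :: int
  proof -
    have t1: "real_of_int t powr (- 1 - \<epsilon>) \<le> 1 powr (- 1 - \<epsilon>)"
      using that \<epsilon> by (intro powr_mono2') auto
    have eq: "\<bar>of_int t * (1 / (1 + s)) - of_int q\<bar> = \<bar>of_int q * s - of_int (t - q)\<bar> / (1 + s)"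
    proof -
      have "of_int t * (1 / (1 + s)) - of_int q = - (of_int q * s - of_int (t - q)) / (1 + s)"
        using s by (simp add: field_simps)
      then show ?thesis
        using s by simp
    qed
    have ge: ?thesis if "1 \<le> \<bar>of_int q * s - of_int (t - q)\<bar>"
    proof -
      have "C * of_int t powr (- 1 - \<epsilon>) \<le> 1 / (1 + s) * 1"
        using t1 s \<open>C > 0\<close> by (intro mult_mono) (auto simp: C_def)
      also have "\<dots> \<le> \<bar>of_int q * s - of_int (t - q)\<bar> / (1 + s)"
        using that s by (simp add: divide_right_mono)
      finally show ?thesis unfolding eq .
    qed
    show ?thesis
    proof (cases "q \<ge> 1 \<and> q \<le> 2 * t")
      case True
      have "C * of_int t powr (- 1 - \<epsilon>) \<le> c * 2 powr (- 1 - \<epsilon>) / (1 + s) * of_int t powr (- 1 - \<epsilon>)"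
        by (intro mult_right_mono) (auto simp: C_def)
      also have "\<dots> = c * (2 * of_int t) powr (- 1 - \<epsilon>) / (1 + s)"
        using that by (simp add: powr_mult)
      also have "\<dots> \<le> c * of_int q powr (- 1 - \<epsilon>) / (1 + s)"
        using True \<epsilon> c s by (intro divide_right_mono mult_left_mono powr_mono2') auto
      also have "\<dots> \<le> \<bar>of_int q * s - of_int (t - q)\<bar> / (1 + s)"
        using c(2)[of q "t - q"] True s by (intro divide_right_mono) auto
      finally show ?thesis unfolding eq .
    next
      case False
      then consider "q \<le> 0" | "q \<ge> 2 * t + 1" by linarith
      then show ?thesis
      proof cases
        case 1
        then have "of_int q * s \<le> 0"
          using s by (simp add: mult_nonpos_nonneg)
        moreover have "real_of_int (t - q) \<ge> 1"
          using 1 that by simp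
        ultimately show ?thesis
          by (intro ge) linarith
      next
        case 2
        then have "of_int q * s \<ge> 0"
          using s that by simp
        moreover have "real_of_int (t - q) \<le> - 1"
          using 2 that by simp
        ultimately show ?thesis
          by (intro ge) linarith
      qed
    qed
  qed
  ultimately show "\<exists>C>0. \<forall>t\<ge>1::int. \<forall>q::int.
      C * of_int t powr (- 1 - \<epsilon>) \<le> \<bar>of_int t * (1 / (1 + s)) - of_int q\<bar>"
    by blast
qed

text \<open>Serves the reflected point, since \<open>1 - a / (a + b) = b / (b + a)\<close>.\<close>

lemma almost_badly_approximable_one_minus:
  assumes "almost_badly_approximable r"
  shows "almost_badly_approximable (1 - r)"
  unfolding almost_badly_approximable_def
proof (intro allI impI)
  fix \<epsilon> :: real assume "\<epsilon> > 0"
  then obtain c where c: "c > 0"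
    "\<And>q p :: int. q \<ge> (1::int) \<Longrightarrow> c * of_int q powr (- 1 - \<epsilon>) \<le> \<bar>of_int q * r - of_int p\<bar>"
    using assms unfolding almost_badly_approximable_def by metis
  have "c * of_int q powr (- 1 - \<epsilon>) \<le> \<bar>of_int q * (1 - r) - of_int p\<bar>" if "q \<ge> 1" for q p :: int
  proof -
    have "of_int q * (1 - r) - of_int p = - (of_int q * r - of_int (q - p))"
      by (simp add: algebra_simps)
    then show ?thesis
      using c(2)[OF that, of "q - p"] by (simp only: abs_minus_cancel)
  qed
  then show "\<exists>c>0. \<forall>q\<ge>1::int. \<forall>p::int. c * of_int q powr (- 1 - \<epsilon>) \<le> \<bar>of_int q * (1 - r) - of_int p\<bar>"
    using c by blast
qed

section \<open>Diophantine exponents\<close>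

lemma rat_denom_pos: "rat_denom r > 0"
  using quotient_of_denom_pos'[of r] by (simp add: rat_denom_def)

lemma rat_denom_minus: "rat_denom (- r) = rat_denom r"
  by (simp add: rat_denom_def rat_uminus_code split: prod.split)

text \<open>One-sided approximations are not stated in lowest terms; passing to the smaller reduced
  denominator only relaxes the bound they must meet.\<close>

lemma rat_denom_le:
  assumes "q > 0"
  shows "rat_denom (of_int p / of_int q) \<le> of_int q"
proof -
  obtain p' q' where pq: "quotient_of (of_int p / of_int q) = (p', q')"
    by (cases "quotient_of (of_int p / of_int q)") auto
  have q': "q' > 0" "coprime p' q'"
    using quotient_of_denom_pos[OF pq] quotient_of_coprime[OF pq] by auto
  have "(of_int p / of_int q :: rat) = of_int p' / of_int q'"
    by (rule quotient_of_div[OF pq])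
  then have "(of_int (p * q') :: rat) = of_int (p' * q)"
    using assms q' by (simp add: field_simps)
  then have "p * q' = p' * q"
    by (simp only: of_int_eq_iff)
  then have "q' dvd p' * q"
    by (metis dvd_triv_right)
  then have "q' dvd q"
    using q' by (simp add: coprime_commute coprime_dvd_mult_right_iff)
  then show ?thesis
    using assms by (simp add: rat_denom_def pq zdvd_imp_le)
qed

text \<open>Finitely many solutions would leave a smallest gap \<open>\<delta>\<close> to
  \<open>\<theta>\<close>; a one-sided approximation with error below
  \<open>1 / N < \<delta>\<close> is a further solution.\<close>

lemma infinite_lower_approximations:
  assumes "\<theta> \<notin> \<rat>"
  shows "infinite {r. 0 < \<theta> - of_rat r \<and> \<theta> - of_rat r < 1 / rat_denom r powr 2}" (is "infinite ?R")
proof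
  assume fin: "finite ?R"
  define \<delta> where "\<delta> = Min (insert 1 ((\<lambda>r. \<theta> - of_rat r) ` ?R))"
  have "\<delta> > 0"
    unfolding \<delta>_def using fin by (subst Min_gr_iff) auto
  have \<delta>: "\<delta> \<le> \<theta> - of_rat r" if "r \<in> ?R" for r
    unfolding \<delta>_def using fin that by (intro Min_le) auto
  obtain N :: nat where N: "N > 0" "1 / N < \<delta>"
    using \<open>\<delta> > 0\<close> by (metis nat_approx_posE zero_less_Suc)
  obtain p q :: int where q: "q > 0" and pq: "0 < q * \<theta> - p" "q * \<theta> - p < 1 / N" "q * (q * \<theta> - p) < 1"
    using one_sided_Dirichlet_approx[OF assms N(1)] by blast
  define r :: rat where "r = of_int p / of_int q"
  have r: "\<theta> - of_rat r = (q * \<theta> - p) / q"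
    using q by (simp add: r_def of_rat_divide field_simps)
  have "\<theta> - of_rat r < 1 / (of_int q)\<^sup>2"
  proof -
    have "(q * \<theta> - p) / q = q * (q * \<theta> - p) / (of_int q)\<^sup>2"
      using q by (simp add: power2_eq_square)
    also have "\<dots> < 1 / (of_int q)\<^sup>2"
      using pq q by (intro divide_strict_right_mono) auto
    finally show ?thesis unfolding r .
  qed
  also have "\<dots> \<le> 1 / (rat_denom r)\<^sup>2"
    using rat_denom_le[OF q, of p] rat_denom_pos[of r] q unfolding r_def
    by (intro divide_left_mono power_mono) auto
  also have "\<dots> = 1 / rat_denom r powr 2"
    using rat_denom_pos[of r] by simp
  finally have "r \<in> ?R"
    using pq q unfolding mem_Collect_eq by (simp add: r)
  then have "\<delta> \<le> (q * \<theta> - p) / q"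
    using \<delta>[of r] by (simp only: r)
  also have "\<dots> \<le> (q * \<theta> - p) / 1"
    using pq q by (intro divide_left_mono) auto
  finally show False
    using pq N by simp
qed

lemma finite_good_approximations:
  assumes "almost_badly_approximable s" "v > 2"
  shows "finite {r. \<bar>s - of_rat r\<bar> < 1 / rat_denom r powr v}"
proof -
  \<comment> \<open>Half of the excess over 2 goes into the lower bound; the other half leaves
    \<open>c * q powr \<epsilon> < 1\<close>, which bounds the denominators and then the
    numerators.\<close>
  define \<epsilon> where "\<epsilon> = (v - 2) / 2"
  have \<epsilon>: "\<epsilon> > 0" "v = 2 + 2 * \<epsilon>"
    using assms by (auto simp: \<epsilon>_def field_simps)
  obtain c where c: "c > 0"
    "\<And>q p :: int. q \<ge> (1::int) \<Longrightarrow> c * of_int q powr (- 1 - \<epsilon>) \<le> \<bar>of_int q * s - of_int p\<bar>"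
    using assms(1) \<epsilon>(1) unfolding almost_badly_approximable_def by metis
  define Q where "Q = (1 / c) powr (1 / \<epsilon>)"
  define P where "P = Q * (\<bar>s\<bar> + 1)"
  have "r \<in> (\<lambda>(p, q). of_int p / of_int q) ` ({- \<lceil>P\<rceil>..\<lceil>P\<rceil>} \<times> {0..\<lceil>Q\<rceil>})"
    if r: "\<bar>s - of_rat r\<bar> < 1 / rat_denom r powr v" for r
  proof -
    obtain p q where pq: "quotient_of r = (p, q)"
      by (cases "quotient_of r") auto
    have q: "q > 0"
      by (rule quotient_of_denom_pos[OF pq])
    have r_eq: "r = of_int p / of_int q"
      by (rule quotient_of_div[OF pq])
    have eq: "\<bar>of_int q * s - of_int p\<bar> = of_int q * \<bar>s - of_rat r\<bar>"
    proof -
      have "of_int q * s - of_int p = of_int q * (s - of_rat r)"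
        using q by (simp add: r_eq of_rat_divide field_simps)
      then show ?thesis
        using q by (simp add: abs_mult)
    qed
    have "of_int q * \<bar>s - of_rat r\<bar> < of_int q * (1 / of_int q powr v)"
      using r q by (intro mult_strict_left_mono) (auto simp: rat_denom_def pq)
    then have small: "\<bar>of_int q * s - of_int p\<bar> < of_int q powr (1 - v)"
      using q by (simp add: eq powr_diff)
    then have "c * of_int q powr (- 1 - \<epsilon>) < of_int q powr (1 - v)"
      using c(2)[of q p] q by simp
    then have "c * of_int q powr (- 1 - \<epsilon>) * of_int q powr (1 + 2 * \<epsilon>)
        < of_int q powr (1 - v) * of_int q powr (1 + 2 * \<epsilon>)"
      using q by (intro mult_strict_right_mono) auto
    then have "c * of_int q powr \<epsilon> < 1"
      using q by (simp add: \<epsilon> mult.assoc flip: powr_add)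
    then have "of_int q powr \<epsilon> \<le> 1 / c"
      using c by (simp add: field_simps)
    then have "(of_int q powr \<epsilon>) powr (1 / \<epsilon>) \<le> Q"
      unfolding Q_def using \<epsilon> by (intro powr_mono2) auto
    then have qQ: "of_int q \<le> Q"
      using q \<epsilon> by (simp add: powr_powr)
    have "of_int q powr (1 - v) \<le> 1 powr (1 - v)"
      using q assms by (intro powr_mono2') auto
    then have "\<bar>of_int q * s - of_int p\<bar> \<le> 1"
      using small by simp
    moreover have "\<bar>of_int q * s\<bar> = of_int q * \<bar>s\<bar>"
      using q by (simp add: abs_mult)
    moreover have "real_of_int q \<ge> 1"
      using q by simp
    ultimately have "\<bar>real_of_int p\<bar> \<le> of_int q * (\<bar>s\<bar> + 1)"
      by (simp add: distrib_left)
    also have "\<dots> \<le> P"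
      unfolding P_def using qQ by (intro mult_right_mono) auto
    finally have "p \<in> {- \<lceil>P\<rceil>..\<lceil>P\<rceil>}"
      by simp linarith
    moreover have "q \<in> {0..\<lceil>Q\<rceil>}"
      using q qQ by simp linarith
    ultimately show ?thesis
      using r_eq by force
  qed
  then have "{r. \<bar>s - of_rat r\<bar> < 1 / rat_denom r powr v}
      \<subseteq> (\<lambda>(p, q). of_int p / of_int q) ` ({- \<lceil>P\<rceil>..\<lceil>P\<rceil>} \<times> {0..\<lceil>Q\<rceil>})"
    by (intro subsetI) (simp only: mem_Collect_eq)
  then show ?thesis
    by (rule finite_subset) simp
qed

lemma dioph_exponents_eq_2:
  assumes irr: "s \<notin> \<rat>" and bad: "almost_badly_approximable s"
  shows "dioph_exponent s = 2" "even_dioph_exponent s = 2" "odd_dioph_exponent s = 2"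
proof -
  let ?D = "\<lambda>v. {r. \<bar>s - of_rat r\<bar> < 1 / rat_denom r powr v}"
  let ?E = "\<lambda>v. {r. 0 < of_rat r - s \<and> of_rat r - s < 1 / rat_denom r powr v}"
  let ?O = "\<lambda>v. {r. 0 < s - of_rat r \<and> s - of_rat r < 1 / rat_denom r powr v}"
  have D: "v \<le> 2" if "infinite (?D v)" for v
    using finite_good_approximations[OF bad, of v] that by fastforce
  have O2: "infinite (?O 2)"
    by (rule infinite_lower_approximations[OF irr])
  \<comment> \<open>Approximations of \<open>s\<close> from above are the negatives of
    approximations of \<open>- s\<close> from below.\<close>
  have "infinite (uminus ` {r. 0 < - s - of_rat r \<and> - s - of_rat r < 1 / rat_denom r powr 2})"
    using infinite_lower_approximations[of "- s"] irr by (simp add: finite_image_iff)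
  moreover have "uminus ` {r. 0 < - s - of_rat r \<and> - s - of_rat r < 1 / rat_denom r powr 2} \<subseteq> ?E 2"
    by (auto simp: of_rat_minus rat_denom_minus)
  ultimately have E2: "infinite (?E 2)"
    using infinite_super by blast
  have ED: "?E v \<subseteq> ?D v" and OD: "?O v \<subseteq> ?D v" for v
    by auto
  \<comment> \<open>One argument for all three exponents: 2 is attained and nothing larger is
    admissible.\<close>
  have sup: "(SUP v\<in>{v. infinite (A v)}. ereal v) = 2"
    if "\<And>v. A v \<subseteq> ?D v" "infinite (A 2)" for A
  proof (rule antisym)
    show "(SUP v\<in>{v. infinite (A v)}. ereal v) \<le> 2"
      using D that(1) infinite_super by (intro SUP_least) fastforce
    have "ereal 2 \<le> (SUP v\<in>{v. infinite (A v)}. ereal v)"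
      using that(2) by (intro SUP_upper) auto
    then show "2 \<le> (SUP v\<in>{v. infinite (A v)}. ereal v)"
      by simp
  qed
  show "dioph_exponent s = 2"
    unfolding dioph_exponent_def using infinite_super[OF OD O2] by (intro sup) auto
  show "even_dioph_exponent s = 2"
    unfolding even_dioph_exponent_def using E2 ED by (intro sup) auto
  show "odd_dioph_exponent s = 2"
    unfolding odd_dioph_exponent_def using O2 OD by (intro sup) auto
qed

section \<open>Forward and backward sums\<close>

lemma bcz_f_pos_eq:
  "bcz_f_pos n p = (\<Sum>i<n. bcz_k ((bcz_map ^^ i) p) - 3)"
proof -
  have "bcz_f_pos n p = (\<Sum>i<n. bcz_kn (int (Suc i)) p - 3)"
    unfolding bcz_f_pos_def One_nat_def by (rule sum.atLeast1_atMost_eq)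
  then show ?thesis
    by (simp add: bcz_kn_def bcz_iter_def)
qed

text \<open>Swapping coordinates conjugates the map to its inverse on the triangle, and
  \<open>bcz_k\<close> takes the same value at \<open>u\<close> and at the swapped image of
  \<open>u\<close>. Hence the index \<open>- i\<close> at \<open>p\<close> matches
  \<open>i + 1\<close> at the swapped point, and \<open>i = 0..n\<close> yields \<open>Suc n\<close>
  terms.\<close>

lemma bcz_f_neg_eq:
  assumes "p \<in> bcz_triangle"
  shows "bcz_f_neg n p = bcz_f_pos (Suc n) (prod.swap p)"
proof -
  have swap: "prod.swap u \<in> bcz_triangle" if "u \<in> bcz_triangle" for u
    using that by (auto simp: bcz_triangle_def)
  have inv: "inv_into bcz_triangle bcz_map u = prod.swap (bcz_map (prod.swap u))"
    if "u \<in> bcz_triangle" for u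
  proof (rule inv_into_f_eq)
    show "inj_on bcz_map bcz_triangle"
      using bij_betw_bcz_map by (rule bij_betw_imp_inj_on)
    show "prod.swap (bcz_map (prod.swap u)) \<in> bcz_triangle"
      by (intro swap bcz_map_in_triangle that)
    show "bcz_map (prod.swap (bcz_map (prod.swap u))) = u"
      by (simp add: swap swap_bcz_map_involution that)
  qed
  have iter_in: "(bcz_map ^^ j) u \<in> bcz_triangle" if "u \<in> bcz_triangle" for u j
    by (induction j) (auto intro: bcz_map_in_triangle that)
  have inv_iter: "(inv_into bcz_triangle bcz_map ^^ j) p = prod.swap ((bcz_map ^^ j) (prod.swap p))" for j
    by (induction j) (simp_all add: inv swap iter_in assms)
  have k: "bcz_k (prod.swap (bcz_map u)) = bcz_k u" if u: "u \<in> bcz_triangle" for u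
  proof -
    obtain a b where ab: "u = (a, b)" by (cases u)
    then have "b > 0"
      using u by (simp add: bcz_triangle_def)
    then show ?thesis
      using swap_bcz_map_involution[OF u] by (simp add: ab bcz_map_def bcz_k_def)
  qed
  have "bcz_kn (- int i) p = bcz_k ((bcz_map ^^ i) (prod.swap p))" for i
  proof -
    have nat_eq: "nat (- (- int i - 1)) = Suc i" by simp
    have "bcz_iter (- int i - 1) = inv_into bcz_triangle bcz_map ^^ Suc i"
      by (simp only: bcz_iter_def nat_eq) (simp del: funpow.simps)
    then have "bcz_kn (- int i) p = bcz_k (prod.swap ((bcz_map ^^ Suc i) (prod.swap p)))"
      by (simp only: bcz_kn_def inv_iter)
    then show ?thesis
      by (simp add: k iter_in swap assms)
  qed
  then show ?thesis
    by (simp add: bcz_f_neg_def bcz_f_pos_eq atLeast0AtMost lessThan_Suc_atMost)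
qed

text \<open>The shifted form is for backward sums, which have one term more; replacing
  \<open>n\<close> by \<open>Suc n\<close> costs arbitrarily little in the exponent.\<close>

lemma growth_exponents:
  assumes p: "p \<in> bcz_triangle" and irr: "fst p / (fst p + snd p) \<notin> \<rat>"
    and bad: "almost_badly_approximable (fst p / (fst p + snd p))"
  shows "limsup (\<lambda>n. elog \<bar>real_of_int (bcz_f_pos n p)\<bar> / ereal (ln (real n))) = ereal (1 / 2)"
    and "limsup (\<lambda>n. elog \<bar>real_of_int (bcz_f_pos (Suc n) p)\<bar> / ereal (ln (real n))) = ereal (1 / 2)"
proof -
  obtain a b where p_eq: "p = (a, b)" by (cases p)
  interpret bcz_orbit a b
    using p p_eq by unfold_locales simp
  have f: "bcz_f_pos n p = f n" for n
    unfolding bcz_f_pos_eq f_def k_def p_eq ..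
  have upper: "\<forall>\<^sub>F n in sequentially. \<bar>real_of_int (f n)\<bar> \<le> real n powr (1 / 2 + \<delta>)" if "\<delta> > 0" for \<delta>
    using bad that by (intro f_upper) (simp_all add: p_eq)
  have lower: "\<exists>\<^sub>F n in sequentially. real n powr y < \<bar>real_of_int (f n)\<bar>" if "0 < y" "y < 1 / 2" for y
    using irr that by (intro f_lower) (simp_all add: p_eq)
  show "limsup (\<lambda>n. elog \<bar>real_of_int (bcz_f_pos n p)\<bar> / ereal (ln (real n))) = ereal (1 / 2)"
    unfolding f using upper lower by (intro limsup_elog_eq_half) auto
  show "limsup (\<lambda>n. elog \<bar>real_of_int (bcz_f_pos (Suc n) p)\<bar> / ereal (ln (real n))) = ereal (1 / 2)"
    unfolding f
  proof (rule limsup_elog_eq_half)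
    fix \<delta> :: real assume \<delta>: "\<delta> > 0"
    have "\<forall>\<^sub>F n in sequentially. real (Suc n) powr (1 / 2 + \<delta> / 2) \<le> real n powr (1 / 2 + \<delta>)"
      using \<delta> by real_asymp
    moreover have "\<forall>\<^sub>F n in sequentially. \<bar>real_of_int (f (Suc n))\<bar> \<le> real (Suc n) powr (1 / 2 + \<delta> / 2)"
      using \<delta> upper[of "\<delta> / 2"]
        eventually_sequentially_Suc[of "\<lambda>n. \<bar>real_of_int (f n)\<bar> \<le> real n powr (1 / 2 + \<delta> / 2)"]
      by simp
    ultimately show "\<forall>\<^sub>F n in sequentially. \<bar>real_of_int (f (Suc n))\<bar> \<le> real n powr (1 / 2 + \<delta>)"
      by eventually_elim linarith
  next
    fix y :: real assume y: "0 < y" "y < 1 / 2"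
    show "\<exists>\<^sub>F n in sequentially. real n powr y < \<bar>real_of_int (f (Suc n))\<bar>"
    proof (rule ccontr)
      assume "\<not> ?thesis"
      then have "\<forall>\<^sub>F n in sequentially. \<bar>real_of_int (f (Suc n))\<bar> \<le> real n powr y"
        by (simp add: frequently_def not_less)
      then have "\<forall>\<^sub>F n in sequentially. \<bar>real_of_int (f (Suc n))\<bar> \<le> real (Suc n) powr y"
      proof eventually_elim
        case (elim n)
        moreover have "real n powr y \<le> real (Suc n) powr y"
          using y by (intro powr_mono2) auto
        ultimately show ?case by linarith
      qed
      then have "\<forall>\<^sub>F n in sequentially. \<bar>real_of_int (f n)\<bar> \<le> real n powr y"
        using eventually_sequentially_Suc[of "\<lambda>n. \<bar>real_of_int (f n)\<bar> \<le> real n powr y"] by simp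
      then show False
        using lower[OF y] by (simp add: frequently_def not_less)
    qed
  qed simp
qed

theorem corollary1p5:
  shows "AE p in (lebesgue :: (real \<times> real) measure).
    p \<in> bcz_triangle \<and> irrational_point p \<longrightarrow>
      dioph_exponent (snd p / fst p) = 2 \<and>
      even_dioph_exponent (snd p / fst p) = 2 \<and>
      odd_dioph_exponent (snd p / fst p) = 2 \<and>
      limsup (\<lambda>n. elog \<bar>real_of_int (bcz_f_pos n p)\<bar> / ereal (ln (real n))) = ereal (1 / 2) \<and>
      limsup (\<lambda>n. elog \<bar>real_of_int (bcz_f_neg n p)\<bar> / ereal (ln (real n))) = ereal (1 / 2)"
  using AE_ratio[OF AE_almost_badly_approximable]
proof eventually_elim
  case (elim p)
  show ?case
  proof (intro impI)
    assume p: "p \<in> bcz_triangle \<and> irrational_point p"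
    obtain a b where ab: "p = (a, b)" by (cases p)
    have pos: "a > 0" "b > 0" and irr: "b / a \<notin> \<rat>"
      using p by (auto simp: ab bcz_triangle_def irrational_point_def)
    have bad: "almost_badly_approximable (b / a)"
      using elim pos by (simp add: ab)
    \<comment> \<open>These are the ratios governing the forward orbits of the point and of its
      reflection.\<close>
    have eq: "1 / (1 + b / a) = a / (a + b)" "1 - a / (a + b) = b / (b + a)"
      using pos by (simp_all add: field_simps)
    have bad1: "almost_badly_approximable (a / (a + b))"
      using almost_badly_approximable_inverse[OF _ bad] pos eq by simp
    then have bad2: "almost_badly_approximable (b / (b + a))"
      using almost_badly_approximable_one_minus eq by metis
    have irr1: "a / (a + b) \<notin> \<rat>"
    proof
      assume "a / (a + b) \<in> \<rat>"
      then have "inverse (a / (a + b)) - 1 \<in> \<rat>"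
        by (intro Rats_diff Rats_inverse Rats_1)
      moreover have "inverse (a / (a + b)) - 1 = b / a"
        using pos by (simp add: field_simps)
      ultimately show False using irr by simp
    qed
    have irr2: "b / (b + a) \<notin> \<rat>"
    proof
      assume "b / (b + a) \<in> \<rat>"
      then have "1 - b / (b + a) \<in> \<rat>"
        by (intro Rats_diff Rats_1)
      moreover have "1 - b / (b + a) = a / (a + b)"
        using pos by (simp add: field_simps)
      ultimately show False using irr1 by simp
    qed
    have swap: "prod.swap p \<in> bcz_triangle"
      using p by (auto simp: bcz_triangle_def)
    show "dioph_exponent (snd p / fst p) = 2 \<and>
      even_dioph_exponent (snd p / fst p) = 2 \<and>
      odd_dioph_exponent (snd p / fst p) = 2 \<and>
      limsup (\<lambda>n. elog \<bar>real_of_int (bcz_f_pos n p)\<bar> / ereal (ln (real n))) = ereal (1 / 2) \<and>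
      limsup (\<lambda>n. elog \<bar>real_of_int (bcz_f_neg n p)\<bar> / ereal (ln (real n))) = ereal (1 / 2)"
      using dioph_exponents_eq_2[OF irr bad] growth_exponents(1)[of p] growth_exponents(2)[OF swap]
        p bad1 bad2 irr1 irr2 bcz_f_neg_eq[of p]
      by (simp add: ab)
  qed
qed

end
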